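(* Let $X=\ell^p(\mathbb{N})$ (respectively $X=\ell^p(\mathbb{Z})$) with $1<p<\infty$, and let $N>2$ be an integer. For each integer $i$ with $1\leq i\leq N$ let $T_i=T_{f_i,w^{(i)}}$ be a unilateral (respectively bilateral) weighted pseudo-shift on $X$. Then $T_1,\dots,T_N$ are disjoint reiteratively hypercyclic if and only if each $T_i$ is reiteratively hypercyclic and $T_1,\dots,T_N$ are disjoint hypercyclic.
   Context: $(e_j)$ is the canonical basis. A weighted pseudo-shift on $\ell^p(\mathbb{Z})$ (bilateral) is given by an invertible map $f:\mathbb{Z}\to\mathbb{Z}$ and a bounded nonzero weight sequence $w=(w_j)_{j\in\mathbb{Z}}$ via $T_{f,w}\big(\sum_j x_je_j\big)=\sum_j w_{f(j)}x_{f(j)}e_j$; a unilateral weighted pseudo-shift on $\ell^p(\mathbb{N})$ is defined by the same formula with $f:\mathbb{N}\to\mathbb{N}$ injective and $w=(w_j)_{j\in\mathbb{N}}$ bounded and nonzero. For $T$ an operator, $x\in X$, $U\subset X$: $N(x,U)=\{n\in\mathbb{N}:T^nx\in U\}$. Upper Banach density: $\overline{Bd}(A)=\lim_{N\to\infty}\limsup_{m\to\infty}\frac{\#(A\cap[m+1,m+N])}{N}$. $T$ is reiteratively hypercyclic if some $x$ satisfies $\overline{Bd}(N(x,U))>0$ for every non-empty open $U$. $T_1,\dots,T_N$ are disjoint hypercyclic (resp. disjoint reiteratively hypercyclic) if $T_1\oplus\cdots\oplus T_N$ on $X^N$ has a hypercyclic (resp. reiteratively hypercyclic) vector of the form $(x,\dots,x)$.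 *)

theory Defs
  imports "HOL-Analysis.Analysis"
begin

text \<open>Sequence space l^p over an index type 'i (nat for l^p(N), int for l^p(Z)),
  with scalars in a normed field 'k (real or complex).\<close>

definition lp :: "real \<Rightarrow> ('i \<Rightarrow> 'k::real_normed_field) set" where
  "lp p = {x. (\<lambda>j. norm (x j) powr p) summable_on UNIV}"

definition lp_norm :: "real \<Rightarrow> ('i \<Rightarrow> 'k::real_normed_field) \<Rightarrow> real" where
  "lp_norm p x = (\<Sum>\<^sub>\<infinity>j. norm (x j) powr p) powr (1 / p)"

definition lp_open :: "real \<Rightarrow> ('i \<Rightarrow> 'k::real_normed_field) set \<Rightarrow> bool" where
  "lp_open p U \<longleftrightarrow> U \<subseteq> lp p \<and>
     (\<forall>y\<in>U. \<exists>e>0. \<forall>z\<in>lp p. lp_norm p (\<lambda>j. z j - y j) < e \<longrightarrow> z \<in> U)"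

definition lp_prod :: "real \<Rightarrow> nat set \<Rightarrow> (nat \<Rightarrow> 'i \<Rightarrow> 'k::real_normed_field) set" where
  "lp_prod p I = {z. (\<forall>i\<in>I. z i \<in> lp p) \<and> (\<forall>i. i \<notin> I \<longrightarrow> z i = (\<lambda>_. 0))}"

definition lp_prod_open :: "real \<Rightarrow> nat set \<Rightarrow> (nat \<Rightarrow> 'i \<Rightarrow> 'k::real_normed_field) set \<Rightarrow> bool" where
  "lp_prod_open p I U \<longleftrightarrow> U \<subseteq> lp_prod p I \<and>
     (\<forall>y\<in>U. \<exists>e>0. \<forall>z\<in>lp_prod p I. (\<forall>i\<in>I. lp_norm p (\<lambda>j. z i j - y i j) < e) \<longrightarrow> z \<in> U)"

definition pseudo_shift :: "('i \<Rightarrow> 'i) \<Rightarrow> ('i \<Rightarrow> 'k::real_normed_field) \<Rightarrow> ('i \<Rightarrow> 'k) \<Rightarrow> ('i \<Rightarrow> 'k)" where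
  "pseudo_shift f w x = (\<lambda>j. w (f j) * x (f j))"

definition admissible_weight :: "('i \<Rightarrow> 'k::real_normed_field) \<Rightarrow> bool" where
  "admissible_weight w \<longleftrightarrow> (\<exists>M. \<forall>j. norm (w j) \<le> M) \<and> (\<forall>j. w j \<noteq> 0)"

definition upper_banach_density :: "nat set \<Rightarrow> real" where
  "upper_banach_density A =
     lim (\<lambda>N. real_of_ereal
       (limsup (\<lambda>m. ereal (real (card (A \<inter> {m+1..m+N})) / real N))))"

definition return_set :: "('a \<Rightarrow> 'a) \<Rightarrow> 'a \<Rightarrow> 'a set \<Rightarrow> nat set" where
  "return_set T x U = {n. (T ^^ n) x \<in> U}"

definition reiteratively_hypercyclic :: "real \<Rightarrow> (('i \<Rightarrow> 'k::real_normed_field) \<Rightarrow> ('i \<Rightarrow> 'k)) \<Rightarrow> bool" where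
  "reiteratively_hypercyclic p T \<longleftrightarrow>
     (\<exists>x\<in>lp p. \<forall>U. lp_open p U \<and> U \<noteq> {} \<longrightarrow> upper_banach_density (return_set T x U) > 0)"

definition direct_sum :: "nat set \<Rightarrow> (nat \<Rightarrow> ('i \<Rightarrow> 'k::real_normed_field) \<Rightarrow> ('i \<Rightarrow> 'k))
    \<Rightarrow> (nat \<Rightarrow> 'i \<Rightarrow> 'k) \<Rightarrow> (nat \<Rightarrow> 'i \<Rightarrow> 'k)" where
  "direct_sum I T z = (\<lambda>i. if i \<in> I then T i (z i) else (\<lambda>_. 0))"

definition diag :: "nat set \<Rightarrow> ('i \<Rightarrow> 'k::real_normed_field) \<Rightarrow> (nat \<Rightarrow> 'i \<Rightarrow> 'k)" where
  "diag I x = (\<lambda>i. if i \<in> I then x else (\<lambda>_. 0))"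

definition disjoint_hypercyclic :: "real \<Rightarrow> nat set \<Rightarrow> (nat \<Rightarrow> ('i \<Rightarrow> 'k::real_normed_field) \<Rightarrow> ('i \<Rightarrow> 'k)) \<Rightarrow> bool" where
  "disjoint_hypercyclic p I T \<longleftrightarrow>
     (\<exists>x\<in>lp p. \<forall>U. lp_prod_open p I U \<and> U \<noteq> {} \<longrightarrow>
        (\<exists>n. ((direct_sum I T) ^^ n) (diag I x) \<in> U))"

definition disjoint_reiteratively_hypercyclic :: "real \<Rightarrow> nat set \<Rightarrow> (nat \<Rightarrow> ('i \<Rightarrow> 'k::real_normed_field) \<Rightarrow> ('i \<Rightarrow> 'k)) \<Rightarrow> bool" where
  "disjoint_reiteratively_hypercyclic p I T \<longleftrightarrow>
     (\<exists>x\<in>lp p. \<forall>U. lp_prod_open p I U \<and> U \<noteq> {} \<longrightarrow>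
        upper_banach_density (return_set (direct_sum I T) (diag I x) U) > 0)"

end

theory Submission
  imports Defs
begin

text \<open>
  Suppose the pseudo-shift \<open>T\<close> is reiteratively hypercyclic. Then \<open>f\<close> has no periodic points, so
  the orbit of each index \<open>j\<close> carries a unique formal fixed vector \<open>Q\<close> of \<open>T\<close> with \<open>Q j = 1\<close>.
  Let \<open>A\<close> be the set of times at which the orbit of a reiteratively hypercyclic vector \<open>x\<close> is close
  to \<open>e\<^sub>j\<close>. If \<open>m\<close> and \<open>m + k\<close> are in \<open>A\<close> and \<open>i\<close> lies \<open>k\<close> steps ahead of \<open>j\<close>, then
  \<open>(T\<^sup>m x) i = Q i * (T\<^sup>m\<^sup>+\<^sup>k x) j\<close> has modulus at least \<open>\<bar>Q i\<bar> / 2\<close>. Averaging over \<open>m\<close> in a window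
  where \<open>A\<close> is dense shows that \<open>Q\<close> is in \<open>l\<^sup>p\<close>. The restrictions of \<open>Q\<close> to positions divisible by
  \<open>n\<close> are \<open>n\<close>-periodic for \<open>T\<close> and tend to \<open>e\<^sub>j\<close>, so for all large \<open>n\<close> vectors of
  period \<open>n\<close> come arbitrarily close to any given vector. Hence every open set of the product contains
  a periodic point of the direct sum. A disjoint hypercyclic vector follows this
  periodic orbit for arbitrarily long times, so its return sets contain arbitrarily long arithmetic
  progressions of a fixed difference and have positive upper Banach density.
\<close>

section \<open>Upper Banach density\<close>

definition window_freq :: "nat set \<Rightarrow> nat \<Rightarrow> real" where
  "window_freq A N =
     real_of_ereal (limsup (\<lambda>m. ereal (real (card (A \<inter> {m+1..m+N})) / real N)))"

lemma upper_banach_density_eq_lim: "upper_banach_density A = lim (window_freq A)"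
  unfolding upper_banach_density_def window_freq_def by simp

lemma card_window_le: "card (A \<inter> {m+1..m+N}) \<le> (N::nat)"
proof -
  have "card (A \<inter> {m+1..m+N}) \<le> card {m+1..m+N}" by (intro card_mono) auto
  then show ?thesis by simp
qed

text \<open>The frequencies lie between 0 and 1, so the extended limsup is finite and
  \<open>real_of_ereal\<close> loses nothing.\<close>

lemma limsup_window: "limsup (\<lambda>m. ereal (real (card (A \<inter> {m+1..m+N})) / real N)) = ereal (window_freq A N)"
proof -
  let ?l = "limsup (\<lambda>m. ereal (real (card (A \<inter> {m+1..m+N})) / real N))"
  have "?l \<le> ereal 1"
    by (intro Limsup_bounded always_eventually)
      (use card_window_le in \<open>auto simp: divide_le_eq_1\<close>)
  moreover have "ereal 0 \<le> ?l"
    by (intro order_trans[OF Liminf_bounded Liminf_le_Limsup]) auto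
  ultimately have "\<bar>?l\<bar> \<noteq> \<infinity>" by auto
  then show ?thesis unfolding window_freq_def by (simp add: ereal_real)
qed

lemma eventually_window_less:
  assumes "window_freq A N < r"
  shows "eventually (\<lambda>m. real (card (A \<inter> {m+1..m+N})) / real N < r) sequentially"
proof -
  have "limsup (\<lambda>m. ereal (real (card (A \<inter> {m+1..m+N})) / real N)) < ereal r"
    unfolding limsup_window using assms by simp
  from Limsup_lessD[OF this] show ?thesis by simp
qed

lemma window_freq_le:
  assumes "eventually (\<lambda>m. real (card (A \<inter> {m+1..m+N})) / real N \<le> r) sequentially"
  shows "window_freq A N \<le> r"
proof -
  have "limsup (\<lambda>m. ereal (real (card (A \<inter> {m+1..m+N})) / real N)) \<le> ereal r"
    by (rule Limsup_bounded) (use assms in simp)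
  then show ?thesis unfolding limsup_window by simp
qed

lemma window_freq_ge:
  assumes "\<And>m0. \<exists>m\<ge>m0. r \<le> real (card (A \<inter> {m+1..m+N})) / real N"
  shows "r \<le> window_freq A N"
proof (rule ccontr)
  assume "\<not> ?thesis"
  then obtain m0 where "\<And>m. m \<ge> m0 \<Longrightarrow> real (card (A \<inter> {m+1..m+N})) / real N < r"
    using eventually_window_less[of A N r] by (auto simp: eventually_sequentially)
  with assms[of m0] show False by force
qed

lemma exists_window_greater:
  assumes "r < window_freq A N"
  shows "\<exists>m\<ge>m0. r < real (card (A \<inter> {m+1..m+N})) / real N"
proof (rule ccontr)
  assume "\<not> ?thesis"
  then have "window_freq A N \<le> r"
    by (intro window_freq_le) (auto simp: eventually_sequentially not_less intro!: exI[of _ m0])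
  with assms show False by simp
qed

lemma window_freq_nonneg: "0 \<le> window_freq A N"
  by (rule window_freq_ge) auto

lemma window_freq_le_one: "window_freq A N \<le> 1"
  by (rule window_freq_le) (use card_window_le in \<open>auto simp: divide_le_eq_1\<close>)

lemma card_windows_le:
  assumes "\<And>m. m \<ge> s \<Longrightarrow> real (card (A \<inter> {m+1..m+L})) \<le> b" "m \<ge> s"
  shows "real (card (A \<inter> {m+1..m+q*L})) \<le> real q * b"
proof (induction q)
  case 0
  then show ?case by simp
next
  case (Suc q)
  have "A \<inter> {m+1..m+Suc q*L} = (A \<inter> {m+1..m+q*L}) \<union> (A \<inter> {(m+q*L)+1..(m+q*L)+L})" by auto
  then have "card (A \<inter> {m+1..m+Suc q*L}) \<le> card (A \<inter> {m+1..m+q*L}) + card (A \<inter> {(m+q*L)+1..(m+q*L)+L})"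
    by (simp only: card_Un_le)
  moreover have "real (card (A \<inter> {(m+q*L)+1..(m+q*L)+L})) \<le> b" using assms by simp
  ultimately show ?case using Suc by (simp add: algebra_simps)
qed

text \<open>A window of length \<open>N\<close> is covered by \<open>N div L + 1\<close> consecutive
  blocks of length \<open>L\<close>. Rounding up to whole blocks costs at most one of them, which is
  the term \<open>r * L / N\<close>.\<close>

lemma window_freq_le_of_shorter:
  assumes "L \<ge> 1" "window_freq A L < r" "N \<ge> 1"
  shows "window_freq A N \<le> r + r * L / N"
proof -
  have r: "r \<ge> 0" using window_freq_nonneg[of A L] assms(2) by simp
  obtain s where "\<And>m. m \<ge> s \<Longrightarrow> real (card (A \<inter> {m+1..m+L})) / real L < r"
    using eventually_window_less[OF assms(2)] by (auto simp: eventually_sequentially)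
  then have s: "real (card (A \<inter> {m+1..m+L})) \<le> r * L" if "m \<ge> s" for m
    using that assms(1) by (fastforce simp: pos_divide_less_eq)
  have "real (card (A \<inter> {m+1..m+N})) / N \<le> r + r * L / N" if "m \<ge> s" for m
  proof -
    define q where "q = N div L + 1"
    have "N < N div L * L + L"
      using assms(1) div_mult_mod_eq[of N L] mod_less_divisor[of L N] by linarith
    then have "N \<le> q * L" unfolding q_def by (simp add: add.commute)
    then have "card (A \<inter> {m+1..m+N}) \<le> card (A \<inter> {m+1..m+q*L})"
      by (intro card_mono) auto
    also have "real \<dots> \<le> real q * (r * L)" by (rule card_windows_le[OF s that])
    also have "\<dots> = (real q * real L) * r" by simp
    also have "\<dots> \<le> (real N + real L) * r"
    proof (rule mult_right_mono[OF _ r])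
      have "q * L \<le> N + L" unfolding q_def by simp
      then show "real q * real L \<le> real N + real L" by (metis of_nat_add of_nat_le_iff of_nat_mult)
    qed
    finally show ?thesis using assms(3) by (simp add: field_simps)
  qed
  then show ?thesis by (intro window_freq_le) (auto simp: eventually_sequentially)
qed

text \<open>A Fekete-type argument: once one frequency is below a bound,
  \<open>window_freq_le_of_shorter\<close> pushes all long windows below it. So the
  \<open>lim\<close> in the definition of the density is a true limit. The infimum starts at 1
  because division by zero makes the frequency 0 at length 0.\<close>

lemma window_freq_tendsto_Inf: "window_freq A \<longlonglongrightarrow> Inf (window_freq A ` {1..})"
proof (rule order_tendstoI)
  have bdd: "bdd_below (window_freq A ` {1..})" using window_freq_nonneg by (auto intro!: bdd_belowI)
  fix x assume x: "x < Inf (window_freq A ` {1..})"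
  have "x < window_freq A N" if "N \<ge> 1" for N
    using x cInf_lower[OF _ bdd, of "window_freq A N"] that by fastforce
  then show "eventually (\<lambda>N. x < window_freq A N) sequentially"
    unfolding eventually_sequentially by blast
next
  fix x assume "Inf (window_freq A ` {1..}) < x"
  then obtain L where L: "L \<ge> 1" "window_freq A L < x"
    using cInf_lessD[of "window_freq A ` {1..}" x] by auto
  then obtain r where r: "window_freq A L < r" "r < x" using dense by blast
  have "(\<lambda>N. r + r * L / real N) \<longlonglongrightarrow> r + 0"
    by (intro tendsto_intros lim_const_over_n)
  then have "eventually (\<lambda>N. r + r * L / real N < x) sequentially"
    using r(2) by (auto dest: order_tendstoD)
  moreover have "eventually (\<lambda>N. N \<ge> (1::nat)) sequentially" by (rule eventually_ge_at_top)
  ultimately show "eventually (\<lambda>N. window_freq A N < x) sequentially"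
    by eventually_elim (use window_freq_le_of_shorter[OF L(1) r(1)] in fastforce)
qed

lemma upper_banach_density_eq_Inf: "upper_banach_density A = Inf (window_freq A ` {1..})"
  unfolding upper_banach_density_eq_lim by (rule limI[OF window_freq_tendsto_Inf])

lemma window_freq_tendsto: "window_freq A \<longlonglongrightarrow> upper_banach_density A"
  unfolding upper_banach_density_eq_Inf by (rule window_freq_tendsto_Inf)

lemma upper_banach_density_le_window_freq: "N \<ge> 1 \<Longrightarrow> upper_banach_density A \<le> window_freq A N"
  unfolding upper_banach_density_eq_Inf using window_freq_nonneg
  by (intro cInf_lower) (auto intro!: bdd_belowI)

lemma upper_banach_density_empty: "upper_banach_density {} = 0"
proof -
  have "window_freq {} N = 0" for N
    by (rule antisym[OF window_freq_le window_freq_nonneg]) simp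
  then have "window_freq {} = (\<lambda>N. 0)" by auto
  with window_freq_tendsto[of "{}"] show ?thesis by (simp add: LIMSEQ_const_iff)
qed

text \<open>The difference \<open>n\<close> is fixed while the start \<open>k\<close> may depend on
  \<open>K\<close>, so each window may use its own progression. A window of length \<open>N\<close>
  along it contains \<open>N div n\<close> terms, whence a density of at least
  \<open>1 / (2 * n)\<close>.\<close>

lemma upper_banach_density_pos_of_progressions:
  assumes n: "n \<ge> 1" and ap: "\<And>K. \<exists>k. \<forall>q\<le>K. k + q * n \<in> A"
  shows "0 < upper_banach_density A"
proof -
  have ge: "real (N div n) / real N \<le> window_freq A N" for N
  proof (rule window_freq_ge)
    fix m0
    obtain k where k: "\<And>q. q \<le> m0 + N \<Longrightarrow> k + q * n \<in> A" using ap[of "m0 + N"] by auto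
    \<comment> \<open>Skipping the first \<open>m0\<close> terms of the progression places the
      window beyond \<open>m0\<close>, as the limsup over window positions demands.\<close>
    define m where "m = k + m0 * n"
    have "m0 \<le> m0 * n" using n by simp
    then have "m \<ge> m0" unfolding m_def by linarith
    have "(\<lambda>q. m + q * n) ` {1..N div n} \<subseteq> A \<inter> {m+1..m+N}"
    proof (rule image_subsetI)
      fix q assume q: "q \<in> {1..N div n}"
      then have "q * n \<le> (N div n) * n" by simp
      then have "q * n \<le> N" by (meson div_times_less_eq_dividend le_trans)
      moreover have "1 \<le> q * n" using q n by simp
      moreover have "q \<le> N" using q by (meson atLeastAtMost_iff div_le_dividend le_trans)
      then have "m + q * n \<in> A" using k[of "m0 + q"] unfolding m_def by (simp add: algebra_simps)
      ultimately show "m + q * n \<in> A \<inter> {m+1..m+N}" by simp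
    qed
    then have "card ((\<lambda>q. m + q * n) ` {1..N div n}) \<le> card (A \<inter> {m+1..m+N})"
      by (intro card_mono) auto
    moreover have "inj_on (\<lambda>q. m + q * n) {1..N div n}" using n by (auto simp: inj_on_def)
    ultimately have "N div n \<le> card (A \<inter> {m+1..m+N})" by (simp add: card_image)
    then show "\<exists>m\<ge>m0. real (N div n) / real N \<le> real (card (A \<inter> {m+1..m+N})) / real N"
      using \<open>m \<ge> m0\<close> by (intro exI[of _ m] conjI divide_right_mono) auto
  qed
  \<comment> \<open>\<open>N div n\<close> exceeds \<open>N / n - 1\<close>, which is at least
    \<open>N / (2 * n)\<close> as soon as \<open>N\<close> is at least \<open>2 * n\<close>.\<close>
  have "1 / (2 * real n) \<le> window_freq A N" if "N \<ge> 2 * n" for N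
  proof -
    have "N < N div n * n + n"
      using n div_mult_mod_eq[of N n] mod_less_divisor[of n N] by linarith
    then have "real N \<le> real (N div n) * n + n"
      by (metis less_imp_le of_nat_add of_nat_le_iff of_nat_mult)
    moreover have "real N \<ge> 2 * real n" using that by (metis of_nat_le_iff of_nat_mult of_nat_numeral)
    ultimately have "1 / (2 * real n) \<le> real (N div n) / real N"
      using n that by (simp add: field_simps)
    also note ge
    finally show ?thesis .
  qed
  then have "1 / (2 * real n) \<le> upper_banach_density A"
    by (intro LIMSEQ_le_const[OF window_freq_tendsto]) auto
  moreover have "0 < 1 / (2 * real n)" using n by simp
  ultimately show ?thesis by linarith
qed

section \<open>Returns to a set of positive density\<close>

lemma card_window_shift_le:
  fixes A :: "nat set" and h :: int
  shows "card (A \<inter> {s+1..s+n}) \<le> card {m \<in> {s+1..s+n}. int m + h \<in> int ` A} + nat \<bar>h\<bar>"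
proof -
  let ?X = "{m \<in> {s+1..s+n}. int m + h \<in> int ` A}"
  \<comment> \<open>Elements that leave the window when translated by \<open>-h\<close> lie in one
    of two end strips, and the sign of \<open>h\<close> makes one of the strips empty.\<close>
  define B where "B = {s+1..s + nat h} \<union> {s+n+1 - nat (-h)..s+n}"
  have "A \<inter> {s+1..s+n} \<subseteq> (\<lambda>m. nat (int m + h)) ` ?X \<union> B"
  proof
    fix a assume a: "a \<in> A \<inter> {s+1..s+n}"
    consider "int a - h < int s + 1" | "int a - h > int s + int n" | "int s + 1 \<le> int a - h" "int a - h \<le> int s + int n"
      by linarith
    then show "a \<in> (\<lambda>m. nat (int m + h)) ` ?X \<union> B"
    proof cases
      case 3
      then have "nat (int a - h) \<in> ?X" using a by auto
      moreover have "nat (int (nat (int a - h)) + h) = a" using 3 by simp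
      ultimately show ?thesis by (metis (no_types, lifting) UnI1 image_eqI)
    qed (use a in \<open>auto simp: B_def\<close>)
  qed
  then have "card (A \<inter> {s+1..s+n}) \<le> card ((\<lambda>m. nat (int m + h)) ` ?X \<union> B)"
    by (intro card_mono) (auto simp: B_def)
  also have "\<dots> \<le> card ((\<lambda>m. nat (int m + h)) ` ?X) + card B" by (rule card_Un_le)
  also have "\<dots> \<le> card ?X + nat \<bar>h\<bar>"
  proof (intro add_mono)
    have "card B \<le> card {s+1..s + nat h} + card {s+n+1 - nat (-h)..s+n}"
      unfolding B_def by (rule card_Un_le)
    also have "\<dots> \<le> nat \<bar>h\<bar>" by auto
    finally show "card B \<le> nat \<bar>h\<bar>" .
  qed (rule card_image_le, simp)
  finally show ?thesis .
qed

lemma upper_banach_density_le_one: "upper_banach_density A \<le> 1"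
  using upper_banach_density_le_window_freq[of 1 A] window_freq_le_one[of A 1] by simp

text \<open>The window length \<open>L\<close> is chosen so that far out no window of length \<open>L\<close> is much denser than
  the upper Banach density \<open>d\<close>; a long window whose density is almost \<open>d\<close> can then
  contain only few translates of \<open>{0..<L}\<close> that miss \<open>A\<close>.\<close>
lemma upper_banach_density_return_windows:
  assumes "0 < upper_banach_density A"
  obtains \<delta> :: real and L :: nat where "\<delta> > 0"
    and "\<And>K. \<exists>W n. W \<subseteq> A \<and> finite W \<and> n > 0 \<and> card W \<le> n \<and>
      (\<forall>k. \<bar>k\<bar> \<le> int K \<longrightarrow> \<delta> * real n \<le> card {m \<in> W. \<exists>t<L. int m + k + int t \<in> int ` A})"
proof -
  define d where "d = upper_banach_density A"
  have d: "0 < d" "d \<le> 1" using assms upper_banach_density_le_one unfolding d_def by auto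
  define \<epsilon> where "\<epsilon> = d / 4"
  have \<epsilon>: "\<epsilon> > 0" using d unfolding \<epsilon>_def by simp
  have "eventually (\<lambda>N. window_freq A N < d * (1 + \<epsilon>)) sequentially"
    using window_freq_tendsto[of A] d \<epsilon> unfolding d_def[symmetric]
    by (intro order_tendstoD) (auto simp: algebra_simps)
  then obtain L0 where L0: "\<And>N. N \<ge> L0 \<Longrightarrow> window_freq A N < d * (1 + \<epsilon>)"
    by (auto simp: eventually_sequentially)
  define L where "L = Suc L0"
  have L: "L \<ge> 1" "window_freq A L < d * (1 + \<epsilon>)" using L0[of L] unfolding L_def by auto
  obtain s0 where s0: "\<And>m. m \<ge> s0 \<Longrightarrow> real (card (A \<inter> {m+1..m+L})) / L < d * (1 + \<epsilon>)"
    using eventually_window_less[OF L(2)] by (auto simp: eventually_sequentially)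
  have "\<exists>W n. W \<subseteq> A \<and> finite W \<and> n > 0 \<and> card W \<le> n \<and>
      (\<forall>k. \<bar>k\<bar> \<le> int K \<longrightarrow> d / 8 * real n \<le> card {m \<in> W. \<exists>t<L. int m + k + int t \<in> int ` A})" for K
  proof -
    \<comment> \<open>The window is so long compared with \<open>K + L\<close> that the boundary
      losses of the shifts below, divided by \<open>d\<close>, stay within
      \<open>n * d / 8\<close>.\<close>
    obtain n0 :: nat where n0: "8 * (real K + real L) / d\<^sup>2 < n0" using reals_Archimedean2 by blast
    define n where "n = Suc n0"
    have n: "n > 0" "8 * (real K + real L) / d\<^sup>2 \<le> n" using n0 unfolding n_def by auto
    have "d * (1 - \<epsilon>) < d" using d \<epsilon> by (simp add: algebra_simps)
    also have "d \<le> window_freq A n"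
      unfolding d_def using n by (intro upper_banach_density_le_window_freq) auto
    \<comment> \<open>Starting at least \<open>K\<close> beyond \<open>s0\<close> keeps every block
      shifted by \<open>k\<close> in the range where windows of length \<open>L\<close> have
      frequency below \<open>d * (1 + \<epsilon>)\<close>.\<close>
    finally obtain s where s: "s \<ge> s0 + K" "d * (1 - \<epsilon>) < real (card (A \<inter> {s+1..s+n})) / real n"
      using exists_window_greater by blast
    define S where "S = {s+1..s+n}"
    define W where "W = A \<inter> S"
    have cW: "n * (d * (1 - \<epsilon>)) < card W"
      using s(2) n(1) unfolding W_def S_def by (simp add: field_simps)
    have "d / 8 * real n \<le> card {m \<in> W. \<exists>t<L. int m + k + int t \<in> int ` A}" if k: "\<bar>k\<bar> \<le> int K" for k
    proof -
      \<comment> \<open>Double counting of the pairs of \<open>m\<close> in \<open>S\<close> and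
        \<open>t < L\<close> for which \<open>m + k + t\<close> is in \<open>A\<close>. Each
        \<open>m\<close> contributes at most \<open>L * (d * (1 + \<epsilon>))\<close> and each
        \<open>t\<close> at least \<open>card W - (K + L)\<close>, so most \<open>m\<close>
        contribute something, that is, lie in \<open>E\<close>.\<close>
      define E where "E = {m \<in> S. \<exists>t<L. int m + k + int t \<in> int ` A}"
      define hits where "hits m = card {t \<in> {..<L}. int m + k + int t \<in> int ` A}" for m
      have finS: "finite S" unfolding S_def by simp
      have hits_le: "real (hits m) \<le> L * (d * (1 + \<epsilon>))" if "m \<in> S" for m
      proof -
        define a where "a = nat (int m + k - 1)"
        have a: "int a = int m + k - 1" "a \<ge> s0" using that k s(1) unfolding a_def S_def by auto
        have "inj_on (\<lambda>t. a + 1 + t) {t \<in> {..<L}. int m + k + int t \<in> int ` A}" by (auto simp: inj_on_def)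
        moreover have "(\<lambda>t. a + 1 + t) ` {t \<in> {..<L}. int m + k + int t \<in> int ` A} \<subseteq> A \<inter> {a+1..a+L}"
        proof (rule image_subsetI)
          fix t assume t: "t \<in> {t \<in> {..<L}. int m + k + int t \<in> int ` A}"
          then obtain b where "b \<in> A" "int m + k + int t = int b" by auto
          moreover from this have "b = a + 1 + t" using a(1) by simp
          ultimately show "a + 1 + t \<in> A \<inter> {a+1..a+L}" using t by simp
        qed
        ultimately have "hits m \<le> card (A \<inter> {a+1..a+L})"
          unfolding hits_def by (intro card_inj_on_le) auto
        also have "real \<dots> \<le> L * (d * (1 + \<epsilon>))"
          using s0[OF a(2)] L(1) by (simp add: field_simps)
        finally show ?thesis by simp
      qed
      have "(\<Sum>m\<in>S. real (hits m)) = (\<Sum>m\<in>E. real (hits m))"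
        using finS by (intro sum.mono_neutral_right) (auto simp: E_def hits_def)
      also have "\<dots> \<le> real (card E) * (L * (d * (1 + \<epsilon>)))"
        using sum_bounded_above[of E "\<lambda>m. real (hits m)"] hits_le by (simp add: E_def)
      finally have upper: "(\<Sum>m\<in>S. real (hits m)) \<le> real (card E) * (L * (d * (1 + \<epsilon>)))" .
      have "(\<Sum>m\<in>S. hits m) = (\<Sum>t\<in>{..<L}. card {m \<in> S. int m + k + int t \<in> int ` A})"
        unfolding hits_def using finS by (intro sum_multicount_gen) auto
      then have "(\<Sum>m\<in>S. real (hits m)) = (\<Sum>t<L. real (card {m \<in> S. int m + k + int t \<in> int ` A}))"
        by (metis (no_types) of_nat_sum)
      also have "\<dots> \<ge> (\<Sum>t<L. real (card W) - (real K + real L))"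
      proof (rule sum_mono)
        fix t assume "t \<in> {..<L}"
        then have "nat \<bar>k + int t\<bar> \<le> K + L" using k by auto
        then have "card W \<le> card {m \<in> S. int m + k + int t \<in> int ` A} + (K + L)"
          using card_window_shift_le[of A s n "k + int t"] unfolding W_def S_def by (simp add: add.assoc)
        then show "real (card W) - (real K + real L) \<le> card {m \<in> S. int m + k + int t \<in> int ` A}" by linarith
      qed
      finally have "L * (real (card W) - (real K + real L)) \<le> real (card E) * (L * (d * (1 + \<epsilon>)))"
        using upper by simp
      then have "L * (real (card W) - (real K + real L)) \<le> L * (real (card E) * (d * (1 + \<epsilon>)))"
        by (simp add: mult.left_commute)
      then have e: "real (card W) - (real K + real L) \<le> real (card E) * (d * (1 + \<epsilon>))"
        using L(1) by (subst (asm) mult_le_cancel_left_pos) auto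
      \<comment> \<open>This rests on
        \<open>(1 - \<epsilon>) / (1 + \<epsilon>) \<ge> 1 - 2 * \<epsilon>\<close>, checked after
        multiplying by \<open>d * (1 + \<epsilon>)\<close>.\<close>
      have E: "n * (1 - 2 * \<epsilon>) - (real K + real L) / d \<le> card E"
      proof (rule ccontr)
        assume "\<not> ?thesis"
        then have "real (card E) * (d * (1 + \<epsilon>)) < (n * (1 - 2 * \<epsilon>) - (real K + real L) / d) * (d * (1 + \<epsilon>))"
          using d \<epsilon> by (intro mult_strict_right_mono) (auto intro!: mult_pos_pos)
        also have "\<dots> = n * (d * (1 - \<epsilon>)) - (real K + real L) - (2 * n * d * \<epsilon>\<^sup>2 + \<epsilon> * (real K + real L))"
          using d by (simp add: field_simps power2_eq_square)
        also have "\<dots> \<le> n * (d * (1 - \<epsilon>)) - (real K + real L)"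
          using d \<epsilon> by (simp only: diff_le_eq le_add_same_cancel1) (intro add_nonneg_nonneg mult_nonneg_nonneg, auto)
        finally show False using e cW by linarith
      qed
      \<comment> \<open>Both sets lie in the \<open>n\<close>-element set \<open>S\<close>. With
        \<open>\<epsilon> = d / 4\<close>, the set \<open>W\<close> has more than
        \<open>n * d * 3 / 4\<close> elements while \<open>E\<close> misses at most
        \<open>n * d * 5 / 8\<close>, which forces an overlap of at least
        \<open>n * d / 8\<close>.\<close>
      have "card (W \<union> E) \<le> card S" using finS unfolding W_def E_def by (intro card_mono) auto
      then have "card (W \<union> E) \<le> n" unfolding S_def by simp
      moreover have "card W + card E = card (W \<union> E) + card (W \<inter> E)"
        using finS by (intro card_Un_Int) (auto simp: W_def E_def)
      moreover have "W \<inter> E = {m \<in> W. \<exists>t<L. int m + k + int t \<in> int ` A}" unfolding W_def E_def by auto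
      ultimately have card_ge: "real (card W) + real (card E) - real n
          \<le> card {m \<in> W. \<exists>t<L. int m + k + int t \<in> int ` A}" by simp
      have KL: "(real K + real L) / d \<le> n * d / 8"
        using n(2) d by (simp add: field_simps power2_eq_square)
      have "n * (d * d) \<le> n * (d * 1)" using d by (intro mult_left_mono) auto
      then have "d / 8 * n \<le> n * (d * (1 - \<epsilon>)) + n * (1 - 2 * \<epsilon>) - n * d / 8 - n"
        unfolding \<epsilon>_def by (simp add: field_simps)
      then show ?thesis using card_ge E KL cW by linarith
    qed
    moreover have "card W \<le> n" unfolding W_def S_def by (rule card_window_le)
    moreover have "W \<subseteq> A" "finite W" unfolding W_def S_def by auto
    ultimately show ?thesis using n(1) by blast
  qed
  then show thesis using that[of "d / 8" L] d by auto
qed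

text \<open>An averaging argument. Summing \<open>ret\<close> over the \<open>m\<close> of a dense
  window counts every \<open>k\<close> of \<open>F\<close> at least \<open>\<delta> * n\<close>
  times, up to a delay \<open>t < L\<close> that \<open>step\<close> absorbs at the cost of a factor
  \<open>M ^ L\<close>. As the window holds at most \<open>n\<close> such \<open>m\<close>, the
  resulting bound does not depend on \<open>F\<close>.\<close>

lemma bounded_sums_of_return_sums:
  fixes c :: "int \<Rightarrow> real"
  assumes "0 < upper_banach_density A" and c: "\<And>k. 0 \<le> c k" and M: "1 \<le> M"
    and step: "\<And>k. c k \<le> M * c (k + 1)"
    and ret: "\<And>m F. m \<in> A \<Longrightarrow> finite F \<Longrightarrow> (\<Sum>k\<in>{k\<in>F. int m + k \<in> int ` A}. c k) \<le> C"
  shows "\<exists>B. \<forall>F. finite F \<longrightarrow> (\<Sum>k\<in>F. c k) \<le> B"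
proof -
  obtain \<delta> L where \<delta>: "\<delta> > 0" and win: "\<And>K. \<exists>W n. W \<subseteq> A \<and> finite W \<and> n > 0 \<and> card W \<le> n \<and>
      (\<forall>k. \<bar>k\<bar> \<le> int K \<longrightarrow> \<delta> * real n \<le> card {m \<in> W. \<exists>t<L. int m + k + int t \<in> int ` A})"
    using upper_banach_density_return_windows[OF assms(1)] by blast
  have "A \<noteq> {}" using assms(1) upper_banach_density_empty by auto
  then have C: "C \<ge> 0" using ret[of _ "{}"] by auto
  have iter: "c k \<le> M ^ t * c (k + int t)" for k t
  proof (induction t)
    case (Suc t)
    have "M ^ t * c (k + int t) \<le> M ^ t * (M * c (k + int t + 1))"
      using M by (intro mult_left_mono step) auto
    with Suc show ?case by (simp add: algebra_simps)
  qed simp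
  have iterL: "c k \<le> M ^ L * c (k + int t)" if "t < L" for k t
    using iter[of k t] mult_right_mono[OF power_increasing[of t L M] c[of "k + int t"]] that M by simp
  have "(\<Sum>k\<in>F. c k) \<le> M ^ L * L * C / \<delta>" if F: "finite F" for F
  proof -
    have fin: "finite ((\<lambda>k. nat \<bar>k\<bar>) ` F)" using F by simp
    define K where "K = Max (insert 0 ((\<lambda>k. nat \<bar>k\<bar>) ` F))"
    have K: "\<bar>k\<bar> \<le> int K" if "k \<in> F" for k
    proof -
      have "nat \<bar>k\<bar> \<le> K" unfolding K_def using fin that by (intro Max_ge) auto
      then show ?thesis by simp
    qed
    obtain W n where W: "W \<subseteq> A" "finite W" "n > 0" "card W \<le> n"
      and hits: "\<And>k. \<bar>k\<bar> \<le> int K \<Longrightarrow> \<delta> * real n \<le> card {m \<in> W. \<exists>t<L. int m + k + int t \<in> int ` A}"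
      using win[of K] by blast
    define H where "H m k \<longleftrightarrow> (\<exists>t<L. int m + k + int t \<in> int ` A)" for m k
    \<comment> \<open>For a fixed delay \<open>t\<close> the shifted offsets \<open>k + t\<close>
      are distinct and lead from \<open>m\<close> back into \<open>A\<close>, so \<open>ret\<close>
      applies to the translate of \<open>F\<close>; there are \<open>L\<close> delays.\<close>
    have row: "(\<Sum>k\<in>F. if H m k then c k else 0) \<le> M ^ L * L * C" if m: "m \<in> W" for m
    proof -
      have "(\<Sum>k\<in>F. if H m k then c k else 0)
          \<le> (\<Sum>k\<in>F. \<Sum>t<L. if int m + k + int t \<in> int ` A then M ^ L * c (k + int t) else 0)"
      proof (rule sum_mono)
        fix k assume "k \<in> F"
        let ?g = "\<lambda>t. if int m + k + int t \<in> int ` A then M ^ L * c (k + int t) else 0"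
        have g: "?g t \<ge> 0" for t using c M by simp
        show "(if H m k then c k else 0) \<le> (\<Sum>t<L. ?g t)"
        proof (cases "H m k")
          case True
          then obtain t where t: "t < L" "int m + k + int t \<in> int ` A" unfolding H_def by blast
          have "c k \<le> ?g t" using t iterL by simp
          also have "\<dots> \<le> (\<Sum>t<L. ?g t)" using t(1) g by (intro member_le_sum) auto
          finally show ?thesis using True by simp
        qed (use g in \<open>simp add: sum_nonneg\<close>)
      qed
      also have "\<dots> = (\<Sum>t<L. \<Sum>k\<in>F. if int m + k + int t \<in> int ` A then M ^ L * c (k + int t) else 0)"
        by (rule sum.swap)
      also have "\<dots> \<le> (\<Sum>t<L. M ^ L * C)"
      proof (rule sum_mono)
        fix t
        have "(\<Sum>k\<in>F. if int m + k + int t \<in> int ` A then M ^ L * c (k + int t) else 0)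
            = (\<Sum>k\<in>(\<lambda>k. k + int t) ` F. if int m + k \<in> int ` A then M ^ L * c k else 0)"
          by (subst sum.reindex) (auto simp: inj_on_def add.assoc)
        also have "\<dots> = (\<Sum>k\<in>{k \<in> (\<lambda>k. k + int t) ` F. int m + k \<in> int ` A}. M ^ L * c k)"
          using F by (subst sum.inter_filter) auto
        also have "\<dots> = M ^ L * (\<Sum>k\<in>{k \<in> (\<lambda>k. k + int t) ` F. int m + k \<in> int ` A}. c k)"
          by (rule sum_distrib_left[symmetric])
        also have "\<dots> \<le> M ^ L * C" using m W(1) F M by (intro mult_left_mono ret) auto
        finally show "(\<Sum>k\<in>F. if int m + k + int t \<in> int ` A then M ^ L * c (k + int t) else 0) \<le> M ^ L * C" .
      qed
      also have "\<dots> = M ^ L * L * C" by simp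
      finally show ?thesis .
    qed
    have "\<delta> * n * (\<Sum>k\<in>F. c k) = (\<Sum>k\<in>F. \<delta> * n * c k)" by (rule sum_distrib_left)
    also have "\<dots> \<le> (\<Sum>k\<in>F. real (card {m \<in> W. H m k}) * c k)"
      using hits K c unfolding H_def by (intro sum_mono mult_right_mono) auto
    also have "\<dots> = (\<Sum>k\<in>F. \<Sum>m\<in>W. if H m k then c k else 0)"
      using W(2) by (intro sum.cong refl) (simp add: sum.inter_filter[symmetric])
    also have "\<dots> = (\<Sum>m\<in>W. \<Sum>k\<in>F. if H m k then c k else 0)" by (rule sum.swap)
    also have "\<dots> \<le> real (card W) * (M ^ L * L * C)" using row by (rule sum_bounded_above)
    also have "\<dots> \<le> real n * (M ^ L * L * C)" using W(4) C M by (intro mult_right_mono) auto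
    finally have "\<delta> * (\<Sum>k\<in>F. c k) \<le> M ^ L * L * C" using W(3) by (simp add: mult.commute mult.left_commute)
    then show ?thesis using \<delta> by (simp add: field_simps)
  qed
  then show ?thesis by blast
qed

section \<open>Sequence spaces\<close>

text \<open>Zero is included because entries of a sequence may vanish. There the inequality reduces
  to \<open>t powr p \<le> t\<close> for \<open>0 < t < 1\<close>.\<close>

lemma powr_convex_atLeast: 
  assumes "p \<ge> 1" shows "convex_on {0..} (\<lambda>x::real. x powr p)"
proof (rule convex_onI)
  fix t x y :: real assume t: "0 < t" "t < 1" and xy: "x \<in> {0..}" "y \<in> {0..}"
  have sm: "u powr p \<le> u" if "0 < u" "u < 1" for u :: real
    using powr_mono'[of 1 p u] that assms by simp
  consider "x = 0" | "y = 0" | "x > 0" "y > 0" using xy by force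
  then show "((1 - t) *\<^sub>R x + t *\<^sub>R y) powr p \<le> (1 - t) * x powr p + t * y powr p"
  proof cases
    case 1
    then show ?thesis using t xy sm[of t] by (simp add: powr_mult mult_right_mono)
  next
    case 2
    then show ?thesis using t xy sm[of "1 - t"] by (simp add: powr_mult mult_right_mono)
  next
    case 3
    then show ?thesis using convex_onD[OF powr_convex[OF assms], of t x y] t by simp
  qed
qed simp

text \<open>\<open>(a + b) / (s + t)\<close> is the convex combination of \<open>a / s\<close> and
  \<open>b / t\<close> with weights \<open>s / (s + t)\<close> and \<open>t / (s + t)\<close>.
  Summed over the coordinates this yields Minkowski's inequality.\<close>

lemma powr_add_convex:
  fixes a b s t p :: real
  assumes "p \<ge> 1" "a \<ge> 0" "b \<ge> 0" "s > 0" "t > 0"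
  shows "(a + b) powr p \<le> (s + t) powr p * (s / (s + t) * (a powr p / s powr p) + t / (s + t) * (b powr p / t powr p))"
proof -
  have "1 - t / (s + t) = s / (s + t)" using assms by (simp add: field_simps)
  then have "(s / (s + t) * (a / s) + t / (s + t) * (b / t)) powr p
      \<le> s / (s + t) * (a / s) powr p + t / (s + t) * (b / t) powr p"
    using convex_onD[OF powr_convex_atLeast[OF assms(1)], of "t/(s+t)" "a/s" "b/t"] assms by simp
  moreover have "s / (s + t) * (a / s) + t / (s + t) * (b / t) = (a + b) / (s + t)"
    using assms by (simp add: add_divide_distrib)
  ultimately have "((a + b) / (s + t)) powr p \<le> s / (s + t) * (a powr p / s powr p) + t / (s + t) * (b powr p / t powr p)"
    using assms by (simp add: powr_divide)
  then show ?thesis using assms by (simp add: powr_divide divide_le_eq mult.commute)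
qed

lemma lp_norm_nonneg: "0 \<le> lp_norm p x"
  unfolding lp_norm_def by simp

lemma lp_norm_powr:
  assumes "p \<ge> 1" shows "lp_norm p x powr p = (\<Sum>\<^sub>\<infinity>j. norm (x j) powr p)"
  unfolding lp_norm_def using assms by (simp add: powr_powr infsum_nonneg)

lemma lp_norm_le_iff:
  assumes "p \<ge> 1" "e \<ge> 0"
  shows "lp_norm p x \<le> e \<longleftrightarrow> (\<Sum>\<^sub>\<infinity>j. norm (x j) powr p) \<le> e powr p"
  unfolding lp_norm_powr[OF assms(1), symmetric] using assms lp_norm_nonneg[of p x]
  by (metis linorder_not_le powr_less_mono2 powr_mono2 less_le_trans order.trans zero_le_one zero_less_one)

lemma lp_norm_less_iff:
  assumes "p \<ge> 1" "e \<ge> 0"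
  shows "lp_norm p x < e \<longleftrightarrow> (\<Sum>\<^sub>\<infinity>j. norm (x j) powr p) < e powr p"
  unfolding lp_norm_powr[OF assms(1), symmetric] using assms lp_norm_nonneg[of p x]
  by (metis linorder_not_le powr_less_mono2 powr_mono2 less_le_trans order.trans zero_le_one zero_less_one)

lemma sum_le_lp_norm_powr:
  assumes "p \<ge> 1" "x \<in> lp p" "finite F"
  shows "(\<Sum>j\<in>F. norm (x j) powr p) \<le> lp_norm p x powr p"
  unfolding lp_norm_powr[OF assms(1)] using assms unfolding lp_def
  by (intro finite_sum_le_infsum) auto

lemma norm_le_lp_norm:
  assumes "p \<ge> 1" "x \<in> lp p"
  shows "norm (x j) \<le> lp_norm p x"
proof (rule ccontr)
  assume "\<not> ?thesis"
  then have "lp_norm p x powr p < norm (x j) powr p"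
    using assms lp_norm_nonneg[of p x] by (intro powr_less_mono2) auto
  with sum_le_lp_norm_powr[OF assms, of "{j}"] show False by simp
qed

lemma lp_zero: "(\<lambda>j. 0) \<in> lp p"
  unfolding lp_def by simp

lemma lp_norm_zero: "lp_norm p (\<lambda>j. 0) = 0"
  unfolding lp_norm_def by simp

lemma lp_finite_support: "finite {j. x j \<noteq> 0} \<Longrightarrow> x \<in> lp p"
  unfolding lp_def by (auto intro!: finite_nonzero_values_imp_summable_on elim: rev_finite_subset)

lemma lp_mono:
  assumes "p \<ge> 1" "y \<in> lp p" "\<And>j. norm (x j) \<le> norm (y j)"
  shows "x \<in> lp p" "lp_norm p x \<le> lp_norm p y"
proof -
  have le: "norm (x j) powr p \<le> norm (y j) powr p" for j using assms by (intro powr_mono2) auto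
  then show x: "x \<in> lp p" using assms(2) unfolding lp_def
    by (auto intro: summable_on_comparison_test[where f="\<lambda>j. norm (y j) powr p"])
  have "(\<Sum>\<^sub>\<infinity>j. norm (x j) powr p) \<le> (\<Sum>\<^sub>\<infinity>j. norm (y j) powr p)"
    using x assms(2) le unfolding lp_def by (intro infsum_mono) auto
  then show "lp_norm p x \<le> lp_norm p y"
    using assms(1) lp_norm_nonneg[of p y] by (simp add: lp_norm_le_iff lp_norm_powr)
qed

lemma lp_cmult:
  assumes "p \<ge> 1" "x \<in> lp p"
  shows "(\<lambda>j. c * x j) \<in> lp p" "lp_norm p (\<lambda>j. c * x j) = norm c * lp_norm p x"
proof -
  have eq: "norm (c * x j) powr p = norm c powr p * norm (x j) powr p" for j
    by (simp add: norm_mult powr_mult)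
  show "(\<lambda>j. c * x j) \<in> lp p" using assms(2) unfolding lp_def mem_Collect_eq eq
    by (rule summable_on_cmult_right)
  show "lp_norm p (\<lambda>j. c * x j) = norm c * lp_norm p x"
    unfolding lp_norm_def eq infsum_cmult_right' using assms
    by (simp add: powr_mult powr_powr infsum_nonneg)
qed

text \<open>Minkowski's inequality with strictly positive upper bounds in place of the norms, so
  that vanishing norms cause no division by zero.\<close>

lemma lp_add_bound:
  assumes p: "p \<ge> 1" and x: "x \<in> lp p" and y: "y \<in> lp p"
    and s: "lp_norm p x \<le> s" "s > 0" and t: "lp_norm p y \<le> t" "t > 0"
  shows "(\<lambda>j. x j + y j) \<in> lp p" "lp_norm p (\<lambda>j. x j + y j) \<le> s + t"
proof -
  define g where "g j = (s + t) powr p *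
    (s / (s + t) * (norm (x j) powr p / s powr p) + t / (s + t) * (norm (y j) powr p / t powr p))" for j
  have sx: "(\<lambda>j. norm (x j) powr p) summable_on UNIV" and sy: "(\<lambda>j. norm (y j) powr p) summable_on UNIV"
    using x y unfolding lp_def by auto
  have "((\<lambda>j. norm (x j) powr p) has_sum lp_norm p x powr p) UNIV"
    "((\<lambda>j. norm (y j) powr p) has_sum lp_norm p y powr p) UNIV"
    unfolding lp_norm_powr[OF p] using sx sy by auto
  then have g: "(g has_sum ((s + t) powr p *
    (s / (s + t) * (lp_norm p x powr p / s powr p) + t / (s + t) * (lp_norm p y powr p / t powr p)))) UNIV"
    unfolding g_def divide_inverse[of _ "_ powr _"]
    by (intro has_sum_cmult_right has_sum_add has_sum_cmult_left)
  have le: "norm (x j + y j) powr p \<le> g j" for j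
  proof -
    have "norm (x j + y j) powr p \<le> (norm (x j) + norm (y j)) powr p"
      using p by (intro powr_mono2 norm_triangle_ineq) auto
    also have "\<dots> \<le> g j" unfolding g_def using p s t by (intro powr_add_convex) auto
    finally show ?thesis .
  qed
  have sg: "g summable_on UNIV" using g by (rule has_sum_imp_summable)
  have sxy: "(\<lambda>j. norm (x j + y j) powr p) summable_on UNIV"
    by (rule summable_on_comparison_test[OF sg]) (use le in auto)
  then show "(\<lambda>j. x j + y j) \<in> lp p" unfolding lp_def by simp
  have "(\<Sum>\<^sub>\<infinity>j. norm (x j + y j) powr p) \<le> (s + t) powr p *
    (s / (s + t) * (lp_norm p x powr p / s powr p) + t / (s + t) * (lp_norm p y powr p / t powr p))"
    using infsum_mono[OF sxy sg le] infsumI[OF g] by simp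
  also have "\<dots> \<le> (s + t) powr p * (s / (s + t) * 1 + t / (s + t) * 1)"
    using s t p lp_norm_nonneg[of p x] lp_norm_nonneg[of p y]
    by (intro mult_left_mono add_mono) (auto simp: divide_le_eq_1 intro!: powr_mono2)
  also have "\<dots> = (s + t) powr p" using s t by (simp add: add_divide_distrib[symmetric])
  finally show "lp_norm p (\<lambda>j. x j + y j) \<le> s + t" using s t p by (simp add: lp_norm_le_iff)
qed

lemma lp_add:
  assumes "p \<ge> 1" "x \<in> lp p" "y \<in> lp p"
  shows "(\<lambda>j. x j + y j) \<in> lp p"
  by (rule lp_add_bound(1)[OF assms, of "lp_norm p x + 1" "lp_norm p y + 1"])
    (use lp_norm_nonneg[of p x] lp_norm_nonneg[of p y] in auto)

lemma lp_norm_triangle: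
  assumes "p \<ge> 1" "x \<in> lp p" "y \<in> lp p"
  shows "lp_norm p (\<lambda>j. x j + y j) \<le> lp_norm p x + lp_norm p y"
proof (rule field_le_epsilon)
  fix e :: real assume e: "e > 0"
  have "lp_norm p (\<lambda>j. x j + y j) \<le> (lp_norm p x + e/2) + (lp_norm p y + e/2)"
    using e lp_norm_nonneg[of p x] lp_norm_nonneg[of p y] 
    by (intro lp_add_bound(2)[OF assms]) (auto simp: add_nonneg_pos)
  then show "lp_norm p (\<lambda>j. x j + y j) \<le> lp_norm p x + lp_norm p y + e" by simp
qed

lemma lp_diff:
  assumes "p \<ge> 1" "x \<in> lp p" "y \<in> lp p"
  shows "(\<lambda>j. x j - y j) \<in> lp p"
  using lp_add[OF assms(1,2) lp_cmult(1)[OF assms(1,3), of "-1"]] by simp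

lemma lp_norm_diff_triangle:
  assumes "p \<ge> 1" "x \<in> lp p" "y \<in> lp p" "z \<in> lp p"
  shows "lp_norm p (\<lambda>j. x j - z j) \<le> lp_norm p (\<lambda>j. x j - y j) + lp_norm p (\<lambda>j. y j - z j)"
  using lp_norm_triangle[OF assms(1) lp_diff[OF assms(1,2,3)] lp_diff[OF assms(1,3,4)]] by simp

lemma lp_norm_minus_commute: "lp_norm p (\<lambda>j. x j - y j) = lp_norm p (\<lambda>j. y j - x j)"
  unfolding lp_norm_def by (simp add: norm_minus_commute)

lemma lp_sum:
  assumes "p \<ge> 1" "finite F" "\<And>i. i \<in> F \<Longrightarrow> v i \<in> lp p"
  shows "(\<lambda>j. \<Sum>i\<in>F. v i j) \<in> lp p \<and> lp_norm p (\<lambda>j. \<Sum>i\<in>F. v i j) \<le> (\<Sum>i\<in>F. lp_norm p (v i))"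
  using assms(2,3)
proof (induction F rule: finite_induct)
  case empty
  then show ?case by (simp add: lp_zero lp_norm_zero)
next
  case (insert i F)
  then have v: "v i \<in> lp p" and IH: "(\<lambda>j. \<Sum>i\<in>F. v i j) \<in> lp p"
      "lp_norm p (\<lambda>j. \<Sum>i\<in>F. v i j) \<le> (\<Sum>i\<in>F. lp_norm p (v i))" by auto
  show ?case
    using lp_add[OF assms(1) v IH(1)] lp_norm_triangle[OF assms(1) v IH(1)] IH(2) insert(1,2) by simp
qed

section \<open>Open balls and small tails\<close>

lemma lp_open_ball:
  assumes "p \<ge> 1" "y \<in> lp p"
  shows "lp_open p {z \<in> lp p. lp_norm p (\<lambda>j. z j - y j) < r}"
  unfolding lp_open_def
proof (intro conjI ballI)
  fix u assume u: "u \<in> {z \<in> lp p. lp_norm p (\<lambda>j. z j - y j) < r}"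
  show "\<exists>e>0. \<forall>z\<in>lp p. lp_norm p (\<lambda>j. z j - u j) < e \<longrightarrow> z \<in> {z \<in> lp p. lp_norm p (\<lambda>j. z j - y j) < r}"
    using u lp_norm_diff_triangle[OF assms(1) _ _ assms(2)]
    by (intro exI[of _ "r - lp_norm p (\<lambda>j. u j - y j)"]) fastforce
qed auto

lemma lp_prod_open_ball:
  assumes "p \<ge> 1" "y \<in> lp_prod p I" "finite I"
  shows "lp_prod_open p I {z \<in> lp_prod p I. \<forall>i\<in>I. lp_norm p (\<lambda>j. z i j - y i j) < r}"
  unfolding lp_prod_open_def
proof (intro conjI ballI)
  fix u assume u: "u \<in> {z \<in> lp_prod p I. \<forall>i\<in>I. lp_norm p (\<lambda>j. z i j - y i j) < r}"
  \<comment> \<open>\<open>insert 1\<close> keeps the minimum meaningful for empty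
    \<open>I\<close>.\<close>
  define e where "e = Min (insert 1 ((\<lambda>i. r - lp_norm p (\<lambda>j. u i j - y i j)) ` I))"
  have "e > 0" unfolding e_def using assms(3) u by auto
  moreover have e: "e \<le> r - lp_norm p (\<lambda>j. u i j - y i j)" if "i \<in> I" for i
    unfolding e_def using assms(3) that by (intro Min_le) auto
  have "lp_norm p (\<lambda>j. z i j - y i j) < r"
    if "z \<in> lp_prod p I" "\<forall>i\<in>I. lp_norm p (\<lambda>j. z i j - u i j) < e" "i \<in> I" for z i
    using lp_norm_diff_triangle[OF assms(1), of "z i" "u i" "y i"] that e[of i] u assms(2)
    by (fastforce simp: lp_prod_def)
  ultimately show "\<exists>e>0. \<forall>z\<in>lp_prod p I. (\<forall>i\<in>I. lp_norm p (\<lambda>j. z i j - u i j) < e)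
    \<longrightarrow> z \<in> {z \<in> lp_prod p I. \<forall>i\<in>I. lp_norm p (\<lambda>j. z i j - y i j) < r}"
    by (intro exI[of _ e]) blast
qed auto

text \<open>Allowing every \<open>G\<close> above \<open>F\<close> lets the finite set be enlarged
  later, as in \<open>periodic_vec_approx\<close>, where \<open>j\<close> is added.\<close>

lemma lp_tail_small:
  assumes "p \<ge> 1" "x \<in> lp p" "e > 0"
  obtains F where "finite F" "\<And>G. F \<subseteq> G \<Longrightarrow> lp_norm p (\<lambda>j. if j \<in> G then 0 else x j) < e"
proof -
  let ?g = "\<lambda>j. norm (x j) powr p"
  have s: "?g summable_on UNIV" using assms unfolding lp_def by simp
  obtain F where F: "finite F" "dist (sum ?g F) (infsum ?g UNIV) \<le> e powr p / 2"
    using infsum_finite_approximation[OF s, of "e powr p / 2"] assms(3) by auto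
  have "lp_norm p (\<lambda>j. if j \<in> G then 0 else x j) < e" if "F \<subseteq> G" for G
  proof -
    have "lp_norm p (\<lambda>j. if j \<in> G then 0 else x j) \<le> lp_norm p (\<lambda>j. if j \<in> F then 0 else x j)"
      using that by (intro lp_mono(2)[OF assms(1)] lp_mono(1)[OF assms(1,2)]) auto
    moreover have "(\<Sum>\<^sub>\<infinity>j. norm (if j \<in> F then 0 else x j) powr p) = (\<Sum>\<^sub>\<infinity>j\<in>UNIV - F. ?g j)"
      by (rule infsum_cong_neutral) auto
    moreover have "(\<Sum>\<^sub>\<infinity>j\<in>UNIV - F. ?g j) = infsum ?g UNIV - sum ?g F"
      using infsum_Diff[OF s, of F] F(1) by simp
    moreover have "\<dots> < e powr p" using F(2) assms(3) 
      by (smt (verit) dist_real_def field_sum_of_halves powr_gt_zero)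
    ultimately show ?thesis using assms lp_norm_less_iff[of p e "\<lambda>j. if j \<in> F then 0 else x j"] by simp
  qed
  with F(1) show thesis by (rule that)
qed

section \<open>Periodic vectors of pseudo-shifts\<close>

text \<open>The product starts at \<open>f i\<close> rather than at \<open>i\<close> because it is
  the factor of the \<open>n\<close>-th iterate in \<open>pseudo_shift_funpow\<close>.\<close>

definition weight_prod :: "('i \<Rightarrow> 'i) \<Rightarrow> ('i \<Rightarrow> 'k::real_normed_field) \<Rightarrow> nat \<Rightarrow> 'i \<Rightarrow> 'k" where
  "weight_prod f w n i = (\<Prod>s<n. w ((f ^^ Suc s) i))"

lemma weight_prod_0 [simp]: "weight_prod f w 0 i = 1"
  unfolding weight_prod_def by simp

lemma weight_prod_Suc: "weight_prod f w (Suc n) i = w (f i) * weight_prod f w n (f i)"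
  unfolding weight_prod_def prod.lessThan_Suc_shift by (simp add: funpow_swap1)

lemma weight_prod_add: "weight_prod f w (m + n) i = weight_prod f w m i * weight_prod f w n ((f ^^ m) i)"
  by (induction m arbitrary: i) (simp_all add: weight_prod_Suc funpow_swap1)

lemma weight_prod_nonzero: "(\<And>j. w j \<noteq> 0) \<Longrightarrow> weight_prod f w n i \<noteq> 0"
  unfolding weight_prod_def by simp

lemma pseudo_shift_funpow:
  "(pseudo_shift f w ^^ n) x i = weight_prod f w n i * x ((f ^^ n) i)"
  by (induction n arbitrary: i) (simp_all add: weight_prod_Suc pseudo_shift_def mult.assoc funpow_swap1[of f])

lemma pseudo_shift_funpow_diff:
  "(pseudo_shift f w ^^ n) (\<lambda>j. x j - y j) = (\<lambda>i. (pseudo_shift f w ^^ n) x i - (pseudo_shift f w ^^ n) y i)"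
  by (auto simp: pseudo_shift_funpow algebra_simps)

text \<open>By injectivity the sequence \<open>x (f j)\<close> lists entries of \<open>x\<close>
  without repetition, so its norm is at most that of \<open>x\<close>; the weights add the factor
  \<open>M\<close>.\<close>

lemma pseudo_shift_lp:
  assumes p: "p \<ge> 1" and f: "inj f" and M: "\<And>j. norm (w j) \<le> M" and x: "x \<in> lp p"
  shows "pseudo_shift f w x \<in> lp p" "lp_norm p (pseudo_shift f w x) \<le> M * lp_norm p x"
proof -
  let ?g = "\<lambda>j. norm (x j) powr p"
  have M0: "M \<ge> 0" using M[of undefined] norm_ge_zero order_trans by blast
  have s: "?g summable_on UNIV" using x unfolding lp_def by simp
  have sr: "?g summable_on range f" by (rule summable_on_subset_banach[OF s]) simp
  have "(\<lambda>j. ?g (f j)) summable_on UNIV"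
    using sr summable_on_reindex[OF f, of ?g] by (simp add: o_def)
  then have y: "(\<lambda>j. x (f j)) \<in> lp p" unfolding lp_def by simp
  have "(\<Sum>\<^sub>\<infinity>j. ?g (f j)) = infsum ?g (range f)"
    using infsum_reindex[OF f, of ?g] by (simp add: o_def)
  also have "\<dots> \<le> infsum ?g UNIV" by (rule infsum_mono2[OF sr s]) auto
  finally have ny: "lp_norm p (\<lambda>j. x (f j)) \<le> lp_norm p x"
    using p lp_norm_nonneg[of p x] by (simp add: lp_norm_le_iff lp_norm_powr)
  have le: "norm (pseudo_shift f w x j) \<le> norm (of_real M * x (f j))" for j
    unfolding pseudo_shift_def using M M0 by (simp add: norm_mult mult_right_mono)
  note My = lp_cmult[OF p y, of "of_real M"]
  show "pseudo_shift f w x \<in> lp p" by (rule lp_mono(1)[OF p My(1) le])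
  have "lp_norm p (pseudo_shift f w x) \<le> M * lp_norm p (\<lambda>j. x (f j))"
    using lp_mono(2)[OF p My(1) le] My(2) M0 by simp
  also have "\<dots> \<le> M * lp_norm p x" by (rule mult_left_mono[OF ny M0])
  finally show "lp_norm p (pseudo_shift f w x) \<le> M * lp_norm p x" .
qed

lemma pseudo_shift_funpow_lp:
  assumes "p \<ge> 1" "inj f" "\<And>j. norm (w j) \<le> M" "x \<in> lp p"
  shows "(pseudo_shift f w ^^ n) x \<in> lp p \<and> lp_norm p ((pseudo_shift f w ^^ n) x) \<le> M ^ n * lp_norm p x"
proof (induction n)
  case (Suc n)
  have M0: "M \<ge> 0" using assms(3)[of undefined] norm_ge_zero order_trans by blast
  show ?case
    using pseudo_shift_lp[where w=w, OF assms(1,2,3) Suc[THEN conjunct1]] mult_left_mono[OF Suc[THEN conjunct2] M0]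
    by (auto simp: mult.assoc)
qed (use assms in simp)

section \<open>Hypercyclicity excludes periodic indices\<close>

definition unit_vec :: "'i \<Rightarrow> 'i \<Rightarrow> 'k::real_normed_field" where
  "unit_vec j = (\<lambda>i. if i = j then 1 else 0)"

lemma unit_vec_lp: "unit_vec j \<in> lp p"
  by (rule lp_finite_support) (simp add: unit_vec_def)

text \<open>If \<open>f\<close> returned to \<open>j\<close> after \<open>q\<close> steps, the
  moduli of the \<open>j\<close>-th coordinates along the orbit would lie on \<open>q\<close>
  geometric sequences with common ratio \<open>a\<close>. For \<open>a \<le> 1\<close> they are
  bounded, for \<open>a > 1\<close> the nonzero ones stay away from 0. Both contradict a dense
  orbit, whose \<open>j\<close>-th coordinates come near every positive number.\<close>

lemma hypercyclic_imp_aperiodic: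
  fixes w :: "'i \<Rightarrow> 'k::real_normed_field"
  assumes p: "p \<ge> 1" and x: "x \<in> lp p"
    and hc: "\<And>U. lp_open p U \<Longrightarrow> U \<noteq> {} \<Longrightarrow> \<exists>n. (pseudo_shift f w ^^ n) x \<in> U"
    and q: "q \<ge> 1"
  shows "(f ^^ q) j \<noteq> j"
proof
  assume per: "(f ^^ q) j = j"
  define v where "v n = (pseudo_shift f w ^^ n) x j" for n
  define a where "a = norm (weight_prod f w q j)"
  have dense: "\<exists>n. r / 2 < norm (v n) \<and> norm (v n) < 3 * r / 2" if r: "r > 0" for r
  proof -
    let ?y = "\<lambda>i. of_real r * unit_vec j i :: 'k"
    have y: "?y \<in> lp p" by (rule lp_cmult(1)[OF p unit_vec_lp])
    have "lp_norm p (\<lambda>i. ?y i - ?y i) < r / 2" using r by (simp add: lp_norm_zero)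
    then have "{z \<in> lp p. lp_norm p (\<lambda>j. z j - ?y j) < r / 2} \<noteq> {}" using y by blast
    then obtain n where n: "(pseudo_shift f w ^^ n) x \<in> {z \<in> lp p. lp_norm p (\<lambda>j. z j - ?y j) < r / 2}"
      using hc[OF lp_open_ball[OF p y]] by blast
    then have "norm (v n - ?y j) < r / 2" unfolding v_def
      using norm_le_lp_norm[OF p lp_diff[OF p _ y], of "(pseudo_shift f w ^^ n) x" j] by auto
    then have "norm (v n - of_real r) < r / 2" by (simp add: unit_vec_def)
    then have "r / 2 < norm (v n) \<and> norm (v n) < 3 * r / 2"
      using norm_triangle_ineq2[of "of_real r" "v n"] norm_triangle_ineq2[of "v n" "of_real r"] r
      by (auto simp: norm_minus_commute)
    then show ?thesis by blast
  qed
  have step: "norm (v (n + q)) = a * norm (v n)" for n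
    unfolding v_def a_def add.commute[of n q] funpow_add o_apply pseudo_shift_funpow[where n=q]
    by (simp add: per norm_mult)
  have "norm (v (n + t * q)) = a ^ t * norm (v n)" for n t
  proof (induction t)
    case (Suc t)
    have "v (n + Suc t * q) = v ((n + t * q) + q)" by (simp add: algebra_simps)
    then show ?case using step[of "n + t * q"] Suc by (simp add: mult.assoc)
  qed simp
  then have geo: "norm (v n) = a ^ (n div q) * norm (v (n mod q))" for n
    by (metis mod_div_mult_eq)
  have modq: "n mod q < q" for n using q by simp
  show False
  proof (cases "a \<le> 1")
    case True
    define B where "B = Max ((\<lambda>n. norm (v n)) ` {..<q})"
    have "norm (v n) \<le> B" for n
    proof -
      have "norm (v n) \<le> 1 * norm (v (n mod q))" unfolding geo[of n]
        using True by (intro mult_right_mono power_le_one) (auto simp: a_def)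
      also have "\<dots> \<le> B" unfolding B_def using modq[of n] by (simp add: Max_ge)
      finally show ?thesis .
    qed
    note B = this
    have "B \<ge> 0" by (rule order_trans[OF norm_ge_zero B])
    then obtain n where "(2 * B + 2) / 2 < norm (v n)" using dense[of "2 * B + 2"] by auto
    with B[of n] show False by simp
  next
    case False
    \<comment> \<open>Vanishing sequences are left out, and \<open>insert 1\<close> covers the case
      that all vanish. Then \<open>dense\<close> at \<open>Min N / 2\<close> gives a nonzero modulus
      below \<open>Min N\<close>.\<close>
    define N where "N = insert 1 ((\<lambda>n. norm (v n)) ` {n. n < q \<and> v n \<noteq> 0})"
    have N: "finite N" "N \<noteq> {}" "\<And>y. y \<in> N \<Longrightarrow> y > 0" unfolding N_def by auto
    then have pos: "Min N > 0" by simp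
    then obtain n where n: "Min N / 4 < norm (v n)" "norm (v n) < 3 * Min N / 4"
      using dense[of "Min N / 2"] pos by auto
    then have "norm (v n) > 0" using pos by linarith
    then have "v (n mod q) \<noteq> 0" unfolding geo[of n] by auto
    then have "Min N \<le> norm (v (n mod q))" using modq[of n] N(1) by (intro Min_le) (auto simp: N_def)
    also have "\<dots> \<le> norm (v n)" unfolding geo[of n]
      using False mult_right_mono[OF one_le_power[of a "n div q"]] by fastforce
    finally show False using n(2) pos by linarith
  qed
qed

section \<open>The orbit of an aperiodic index and its formal fixed vector\<close>

locale aperiodic_shift =
  fixes f :: "'i \<Rightarrow> 'i" and w :: "'i \<Rightarrow> 'k::real_normed_field" and j :: 'i
  assumes inj: "inj f" and nonzero: "\<And>i. w i \<noteq> 0" and aperiodic: "\<And>q. q \<ge> 1 \<Longrightarrow> (f ^^ q) j \<noteq> j"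
begin

lemma funpow_inj: "(f ^^ n) x = (f ^^ n) y \<Longrightarrow> x = y"
  using inj_fn[OF inj, of n] by (auto dest: injD)

lemma funpow_add_apply: "(f ^^ (m + n)) x = (f ^^ m) ((f ^^ n) x)"
  by (simp add: funpow_add)

lemma funpow_j_eq: "(f ^^ m) j = (f ^^ n) j \<Longrightarrow> m = n"
proof (induction m n rule: linorder_wlog)
  case (le m n)
  then have "(f ^^ m) j = (f ^^ m) ((f ^^ (n - m)) j)" by (simp flip: funpow_add_apply)
  then have "(f ^^ (n - m)) j = j" using funpow_inj by metis
  with aperiodic[of "n - m"] le(1) show ?case by force
qed simp

text \<open>The index \<open>i\<close> lies \<open>k\<close> steps ahead of \<open>j\<close> on the (one- or two-sided) \<open>f\<close>-orbit of \<open>j\<close>.\<close>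
definition at_pos :: "int \<Rightarrow> 'i \<Rightarrow> bool" where
  "at_pos k i \<longleftrightarrow> (\<exists>a b. int b - int a = k \<and> (f ^^ a) i = (f ^^ b) j)"

text \<open>The two relations express \<open>(f ^^ (a + a')) i\<close> as an iterate of
  \<open>j\<close> in two ways, and these iterates never repeat. So \<open>b - a\<close> depends on
  \<open>i\<close> only, which makes positions well defined.\<close>

lemma orbit_indices:
  assumes "(f ^^ a) i = (f ^^ b) j" "(f ^^ a') i = (f ^^ b') j"
  shows "a + b' = a' + b"
proof -
  have "(f ^^ (a' + b)) j = (f ^^ (a' + a)) i" using assms(1) by (simp add: funpow_add_apply)
  also have "\<dots> = (f ^^ (a + b')) j" using assms(2) by (simp add: add.commute[of a'] funpow_add_apply)
  finally show ?thesis using funpow_j_eq by metis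
qed

lemma at_pos_unique_pos: "at_pos k i \<Longrightarrow> at_pos k' i \<Longrightarrow> k = k'"
  unfolding at_pos_def using orbit_indices by fastforce

text \<open>By injectivity of \<open>f\<close>, every pair of exponents with the right difference is
  a witness, not only the pair supplied by \<open>at_pos\<close>.\<close>

lemma at_pos_indices:
  assumes "at_pos (int n - int m) i"
  shows "(f ^^ m) i = (f ^^ n) j"
proof -
  obtain a b where ab: "int b - int a = int n - int m" "(f ^^ a) i = (f ^^ b) j"
    using assms unfolding at_pos_def by blast
  then have "m + b = a + n" by linarith
  have "(f ^^ a) ((f ^^ m) i) = (f ^^ m) ((f ^^ a) i)" by (simp add: add.commute flip: funpow_add_apply)
  also have "\<dots> = (f ^^ (a + n)) j" using ab(2) \<open>m + b = a + n\<close> by (simp flip: funpow_add_apply)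
  finally show ?thesis using funpow_inj by (metis funpow_add_apply)
qed

lemma at_pos_unique_index: 
  assumes "at_pos k i" "at_pos k i'" shows "i = i'"
proof -
  have "k = int (nat k) - int (nat (- k))" by simp
  then have "(f ^^ nat (- k)) i = (f ^^ nat k) j" "(f ^^ nat (- k)) i' = (f ^^ nat k) j"
    using assms by (metis at_pos_indices)+
  then show ?thesis using funpow_inj by metis
qed

lemma at_pos_step: "at_pos k i \<Longrightarrow> at_pos (k + int n) ((f ^^ n) i)"
proof -
  assume "at_pos k i"
  then obtain a b where ab: "int b - int a = k" "(f ^^ a) i = (f ^^ b) j" unfolding at_pos_def by blast
  have "(f ^^ a) ((f ^^ n) i) = (f ^^ (n + b)) j"
    using ab(2) by (simp add: funpow_add_apply) (metis add.commute funpow_add_apply)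
  with ab(1) show ?thesis unfolding at_pos_def by (intro exI[of _ a] exI[of _ "n + b"]) auto
qed

lemma at_pos_step_back: "at_pos k ((f ^^ n) i) \<Longrightarrow> at_pos (k - int n) i"
  unfolding at_pos_def by (force simp flip: funpow_add_apply)

text \<open>The formal fixed vector of the pseudo-shift supported on the orbit of \<open>j\<close> with
  \<open>j\<close>-th entry \<open>1\<close>; the quotient does not depend on the choice of \<open>a\<close> and \<open>b\<close>.\<close>
definition fixed_vec :: "'i \<Rightarrow> 'k" where
  "fixed_vec i = (if \<exists>k. at_pos k i
     then (case SOME (a, b). (f ^^ a) i = (f ^^ b) j of (a, b) \<Rightarrow> weight_prod f w a i / weight_prod f w b j)
     else 0)"

text \<open>Extending both exponents by \<open>t\<close> multiplies numerator and denominator by the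
  same nonzero product. Extending by \<open>b'\<close> and by \<open>b\<close> respectively makes
  the two fractions identical, because of \<open>orbit_indices\<close>.\<close>

lemma weight_prod_ratio:
  assumes "(f ^^ a) i = (f ^^ b) j" "(f ^^ a') i = (f ^^ b') j"
  shows "weight_prod f w a i / weight_prod f w b j = weight_prod f w a' i / weight_prod f w b' j"
proof -
  have *: "weight_prod f w a i / weight_prod f w b j = weight_prod f w (a + t) i / weight_prod f w (b + t) j"
    if "(f ^^ a) i = (f ^^ b) j" for a b t
    using weight_prod_nonzero[OF nonzero, where n=t and i="(f ^^ b) j"] that by (simp add: weight_prod_add)
  have "a + b' = a' + b" by (rule orbit_indices[OF assms])
  then show ?thesis
    using *[OF assms(1), of b'] *[OF assms(2), of b] by (simp add: add.commute)
qed

lemma fixed_vec_eq: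
  assumes "(f ^^ a) i = (f ^^ b) j"
  shows "fixed_vec i = weight_prod f w a i / weight_prod f w b j"
proof -
  have ex: "\<exists>k. at_pos k i" using assms unfolding at_pos_def by blast
  define s where "s = (SOME (a, b). (f ^^ a) i = (f ^^ b) j)"
  have "case s of (a, b) \<Rightarrow> (f ^^ a) i = (f ^^ b) j" unfolding s_def by (rule someI[of _ "(a, b)"]) (use assms in simp)
  then show ?thesis using ex weight_prod_ratio[OF _ assms]
    unfolding fixed_vec_def s_def[symmetric] by (auto split: prod.splits)
qed

lemma fixed_vec_j: "fixed_vec j = 1"
  using fixed_vec_eq[of 0 j 0] by simp

lemma fixed_vec_fixed: "weight_prod f w n i * fixed_vec ((f ^^ n) i) = fixed_vec i"
proof (cases "\<exists>k. at_pos k ((f ^^ n) i)")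
  case True
  then obtain a b where ab: "(f ^^ a) ((f ^^ n) i) = (f ^^ b) j" unfolding at_pos_def by blast
  have "(f ^^ (n + a)) i = (f ^^ b) j" using ab by (metis add.commute funpow_add_apply)
  from fixed_vec_eq[OF this] fixed_vec_eq[OF ab] show ?thesis by (simp add: weight_prod_add)
next
  case False
  then have "\<nexists>k. at_pos k i" using at_pos_step by blast
  with False show ?thesis unfolding fixed_vec_def by simp
qed

lemma fixed_vec_step: "fixed_vec i = w (f i) * fixed_vec (f i)"
  using fixed_vec_fixed[of 1 i] by (simp add: weight_prod_Suc)

text \<open>Since \<open>(f ^^ m) i = (f ^^ n) j\<close>, both iterates read the same coordinate of
  \<open>x\<close>, and their weight products differ by the factor \<open>fixed_vec i\<close>. A
  time \<open>n\<close> with a large \<open>j\<close>-th coordinate thus bounds an entry of the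
  \<open>m\<close>-th iterate from below.\<close>

lemma pseudo_shift_funpow_at_pos:
  assumes "at_pos (int n - int m) i"
  shows "(pseudo_shift f w ^^ m) x i = fixed_vec i * (pseudo_shift f w ^^ n) x j"
  using fixed_vec_eq[OF at_pos_indices[OF assms]] at_pos_indices[OF assms]
    weight_prod_nonzero[OF nonzero, where n=n and i=j]
  by (simp add: pseudo_shift_funpow)

lemma fixed_vec_lp:
  assumes p: "p \<ge> 1" and M: "\<And>i. norm (w i) \<le> M" and x: "x \<in> lp p"
    and dens: "0 < upper_banach_density (return_set (pseudo_shift f w) x
      {z \<in> lp p. lp_norm p (\<lambda>i. z i - unit_vec j i) < 1 / 2})"
  shows "fixed_vec \<in> lp p"
proof -
  define A where "A = return_set (pseudo_shift f w) x {z \<in> lp p. lp_norm p (\<lambda>i. z i - unit_vec j i) < 1 / 2}"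
  define idx where "idx k = (THE i. at_pos k i)" for k
  define pos where "pos i = (THE k. at_pos k i)" for i
  have idx: "at_pos k i \<Longrightarrow> idx k = i" for k i
    unfolding idx_def using at_pos_unique_index by (blast intro: the_equality)
  have pos: "at_pos k i \<Longrightarrow> pos i = k" for k i
    unfolding pos_def using at_pos_unique_pos by (blast intro: the_equality)
  \<comment> \<open>A one-sided orbit leaves some positions empty; these get the value 0. The step
    inequality survives, since an occupied position \<open>k\<close> is followed by an occupied
    position \<open>k + 1\<close>.\<close>
  define c where "c k = (if \<exists>i. at_pos k i then norm (fixed_vec (idx k)) powr p else 0)" for k
  define M' where "M' = max 1 M"
  have M': "M' \<ge> 1" "\<And>i. norm (w i) \<le> M'" using M unfolding M'_def by (auto simp: le_max_iff_disj)
  \<comment> \<open>\<open>D\<close> bounds the norm of every iterate at a time in \<open>A\<close>.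
    The factor \<open>2 powr p\<close> below arises because the \<open>j\<close>-th coordinate at
    such a time has modulus at least \<open>1 / 2\<close>.\<close>
  define D where "D = lp_norm p (unit_vec j :: 'i \<Rightarrow> 'k) + 1 / 2"
  have "\<exists>B. \<forall>F. finite F \<longrightarrow> (\<Sum>k\<in>F. c k) \<le> B"
  proof (rule bounded_sums_of_return_sums[where A=A and M="M' powr p" and C="2 powr p * D powr p"])
    show "0 < upper_banach_density A" using dens unfolding A_def .
    show "0 \<le> c k" for k unfolding c_def by simp
    show "1 \<le> M' powr p" using M'(1) p by (simp add: ge_one_powr_ge_zero)
    show "c k \<le> M' powr p * c (k + 1)" for k
    proof (cases "\<exists>i. at_pos k i")
      case True
      then obtain i where i: "at_pos k i" by blast
      have fi: "at_pos (k + 1) (f i)" using at_pos_step[OF i, of 1] by simp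
      have "norm (fixed_vec i) powr p \<le> (M' * norm (fixed_vec (f i))) powr p"
        unfolding fixed_vec_step[of i] using p M' by (intro powr_mono2) (auto simp: norm_mult mult_right_mono)
      then have "norm (fixed_vec i) powr p \<le> M' powr p * norm (fixed_vec (f i)) powr p"
        using M' by (simp add: powr_mult)
      then show ?thesis unfolding c_def using i fi idx[OF i] idx[OF fi] by auto
    qed (simp add: c_def)
    show "(\<Sum>k\<in>{k\<in>F. int m + k \<in> int ` A}. c k) \<le> 2 powr p * D powr p" if m: "m \<in> A" and F: "finite F" for m F
    proof -
      define y where "y = (pseudo_shift f w ^^ m) x"
      have y: "y \<in> lp p" "lp_norm p (\<lambda>i. y i - unit_vec j i) < 1 / 2"
        using m unfolding A_def return_set_def y_def by auto
      have "lp_norm p y \<le> D" unfolding D_def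
        using lp_norm_triangle[OF p lp_diff[OF p y(1) unit_vec_lp[of j]] unit_vec_lp[of j]] y(2) by simp
      then have yD: "lp_norm p y powr p \<le> D powr p" using p lp_norm_nonneg[of p y] by (intro powr_mono2) auto
      define F' where "F' = {k\<in>F. int m + k \<in> int ` A \<and> (\<exists>i. at_pos k i)}"
      have "(\<Sum>k\<in>{k\<in>F. int m + k \<in> int ` A}. c k) = (\<Sum>k\<in>F'. c k)"
        unfolding F'_def c_def using F by (intro sum.mono_neutral_right) auto
      also have "\<dots> \<le> (\<Sum>k\<in>F'. 2 powr p * norm (y (idx k)) powr p)"
      proof (rule sum_mono)
        fix k assume k: "k \<in> F'"
        then obtain i n where i: "at_pos k i" and n: "n \<in> A" "int m + k = int n" unfolding F'_def by auto
        have "k = int n - int m" using n(2) by simp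
        then have yi: "y i = fixed_vec i * (pseudo_shift f w ^^ n) x j"
          using pseudo_shift_funpow_at_pos i unfolding y_def by blast
        let ?z = "(pseudo_shift f w ^^ n) x"
        have z: "?z \<in> lp p" "lp_norm p (\<lambda>i. ?z i - unit_vec j i) < 1 / 2"
          using n(1) unfolding A_def return_set_def by auto
        then have "norm (?z j - 1) < 1 / 2"
          using norm_le_lp_norm[OF p lp_diff[OF p z(1) unit_vec_lp[of j]], of j] by (simp add: unit_vec_def)
        then have "1 \<le> 2 * norm (?z j)"
          using norm_triangle_ineq2[of 1 "?z j"] by (simp add: norm_minus_commute)
        then have "norm (fixed_vec i) * 1 \<le> norm (fixed_vec i) * (2 * norm (?z j))"
          by (intro mult_left_mono) auto
        then have "norm (fixed_vec i) \<le> 2 * norm (y i)" unfolding yi by (simp add: norm_mult)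
        then have "norm (fixed_vec i) powr p \<le> (2 * norm (y i)) powr p" using p by (intro powr_mono2) auto
        then show "c k \<le> 2 powr p * norm (y (idx k)) powr p"
          unfolding c_def using i idx[OF i] by (auto simp: powr_mult)
      qed
      also have "\<dots> = 2 powr p * (\<Sum>k\<in>F'. norm (y (idx k)) powr p)" by (rule sum_distrib_left[symmetric])
      also have "(\<Sum>k\<in>F'. norm (y (idx k)) powr p) = (\<Sum>i\<in>idx ` F'. norm (y i) powr p)"
      proof -
        have "inj_on idx F'"
        proof (rule inj_onI)
          fix k l assume kl: "k \<in> F'" "l \<in> F'" "idx k = idx l"
          then have "at_pos k (idx k)" "at_pos l (idx l)" using idx unfolding F'_def by auto
          then show "k = l" using kl(3) at_pos_unique_pos by metis
        qed
        then show ?thesis by (simp add: sum.reindex)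
      qed
      also have "2 powr p * (\<Sum>i\<in>idx ` F'. norm (y i) powr p) \<le> 2 powr p * D powr p"
        using sum_le_lp_norm_powr[OF p y(1), of "idx ` F'"] yD F by (intro mult_left_mono) (auto simp: F'_def)
      finally show ?thesis .
    qed
  qed
  then obtain B where B: "\<And>F. finite F \<Longrightarrow> (\<Sum>k\<in>F. c k) \<le> B" by blast
  have "(\<Sum>i\<in>G. norm (fixed_vec i) powr p) \<le> B" if G: "finite G" for G
  proof -
    define G' where "G' = {i\<in>G. \<exists>k. at_pos k i}"
    have "(\<Sum>i\<in>G. norm (fixed_vec i) powr p) = (\<Sum>i\<in>G'. norm (fixed_vec i) powr p)"
      unfolding G'_def using G by (intro sum.mono_neutral_right) (auto simp: fixed_vec_def)
    also have "\<dots> = (\<Sum>i\<in>G'. c (pos i))"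
      unfolding G'_def c_def by (intro sum.cong) (auto simp: pos idx)
    also have "\<dots> = (\<Sum>k\<in>pos ` G'. c k)"
    proof -
      have "inj_on pos G'"
      proof (rule inj_onI)
        fix h i assume hi: "h \<in> G'" "i \<in> G'" "pos h = pos i"
        then have "at_pos (pos h) h" "at_pos (pos i) i" using pos unfolding G'_def by auto
        then show "h = i" using hi(3) at_pos_unique_index by metis
      qed
      then show ?thesis by (simp add: sum.reindex)
    qed
    also have "\<dots> \<le> B" using G by (intro B) (simp add: G'_def)
    finally show ?thesis .
  qed
  then show ?thesis unfolding lp_def mem_Collect_eq
    by (intro nonneg_bdd_above_summable_on) (auto intro!: bdd_aboveI)
qed

section \<open>Periodic vectors and their density\<close>

definition periodic_vec :: "nat \<Rightarrow> 'i \<Rightarrow> 'k" where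
  "periodic_vec n i = (if \<exists>k. int n dvd k \<and> at_pos k i then fixed_vec i else 0)"

text \<open>Applying \<open>f ^^ n\<close> moves a position by \<open>n\<close>, which keeps
  divisibility by \<open>n\<close>; on the surviving entries \<open>fixed_vec_fixed\<close>
  applies.\<close>

lemma periodic_vec_periodic: "(pseudo_shift f w ^^ n) (periodic_vec n) = periodic_vec n"
proof
  fix i
  have "(\<exists>k. int n dvd k \<and> at_pos k ((f ^^ n) i)) \<longleftrightarrow> (\<exists>k. int n dvd k \<and> at_pos k i)"
  proof
    assume "\<exists>k. int n dvd k \<and> at_pos k ((f ^^ n) i)"
    then obtain k where "int n dvd k" "at_pos k ((f ^^ n) i)" by blast
    then show "\<exists>k. int n dvd k \<and> at_pos k i"
      using at_pos_step_back by (intro exI[of _ "k - int n"]) auto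
  next
    assume "\<exists>k. int n dvd k \<and> at_pos k i"
    then obtain k where "int n dvd k" "at_pos k i" by blast
    then show "\<exists>k. int n dvd k \<and> at_pos k ((f ^^ n) i)"
      using at_pos_step by (intro exI[of _ "k + int n"]) auto
  qed
  then show "(pseudo_shift f w ^^ n) (periodic_vec n) i = periodic_vec n i"
    unfolding pseudo_shift_funpow periodic_vec_def using fixed_vec_fixed[of n i] by auto
qed

lemma periodic_vec_lp:
  assumes "p \<ge> 1" "fixed_vec \<in> lp p"
  shows "periodic_vec n \<in> lp p"
  by (rule lp_mono(1)[OF assms]) (simp add: periodic_vec_def)

text \<open>An index of the orbit other than \<open>j\<close> sits at some
  \<open>k \<noteq> 0\<close> and is deleted once \<open>n > \<bar>k\<bar>\<close>. So on a finite
  set the vector eventually agrees with \<open>unit_vec j\<close>, and off that set it is dominated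
  by a small tail of \<open>fixed_vec\<close>.\<close>

lemma periodic_vec_approx:
  assumes p: "p \<ge> 1" and lp: "fixed_vec \<in> lp p" and e: "e > 0"
  shows "eventually (\<lambda>n. lp_norm p (\<lambda>i. periodic_vec n i - unit_vec j i) < e) sequentially"
proof -
  obtain F where F: "finite F" and tail: "\<And>G. F \<subseteq> G \<Longrightarrow> lp_norm p (\<lambda>i. if i \<in> G then 0 else fixed_vec i) < e"
    using lp_tail_small[OF p lp e] by blast
  have "eventually (\<lambda>n. i \<noteq> j \<longrightarrow> periodic_vec n i = 0) sequentially" for i
  proof (cases "i \<noteq> j \<and> (\<exists>k. at_pos k i)")
    case True
    then obtain k where k: "i \<noteq> j" "at_pos k i" by blast
    have "at_pos 0 j" unfolding at_pos_def by auto
    then have "k \<noteq> 0" using k at_pos_unique_index by blast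
    have "periodic_vec n i = 0" if "n \<ge> nat \<bar>k\<bar> + 1" for n
    proof -
      have "\<not> int n dvd k" using that \<open>k \<noteq> 0\<close> by (auto dest!: dvd_imp_le_int)
      then show ?thesis unfolding periodic_vec_def using at_pos_unique_pos k(2) by auto
    qed
    then show ?thesis unfolding eventually_sequentially by blast
  qed (auto simp: periodic_vec_def)
  then have "eventually (\<lambda>n. \<forall>i\<in>F. i \<noteq> j \<longrightarrow> periodic_vec n i = 0) sequentially"
    using F by (intro eventually_ball_finite) auto
  then show ?thesis
  proof eventually_elim
    case (elim n)
    have "periodic_vec n j = 1" unfolding periodic_vec_def fixed_vec_j
      by (auto simp: at_pos_def intro!: exI[of _ 0])
    moreover have "norm (periodic_vec n i) \<le> norm (fixed_vec i)" for i unfolding periodic_vec_def by simp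
    ultimately have le: "norm (periodic_vec n i - unit_vec j i) \<le> norm (if i \<in> insert j F then 0 else fixed_vec i)" for i
      using elim by (auto simp: unit_vec_def)
    have "lp_norm p (\<lambda>i. periodic_vec n i - unit_vec j i) \<le> lp_norm p (\<lambda>i. if i \<in> insert j F then 0 else fixed_vec i)"
      by (rule lp_mono(2)[OF p _ le]) (rule lp_mono(1)[OF p lp], simp)
    also have "\<dots> < e" by (rule tail) auto
    finally show ?case .
  qed
qed

end

lemma reiteratively_hypercyclic_imp_periodic_dense:
  fixes w :: "'i \<Rightarrow> 'k::real_normed_field"
  assumes p: "p \<ge> 1" and f: "inj f" and w: "admissible_weight w"
    and rh: "reiteratively_hypercyclic p (pseudo_shift f w)"
    and y: "y \<in> lp p" and e: "e > 0"
  shows "eventually (\<lambda>n. \<exists>z\<in>lp p. (pseudo_shift f w ^^ n) z = z \<and> lp_norm p (\<lambda>i. z i - y i) < e) sequentially"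
proof -
  obtain M where M: "\<And>j. norm (w j) \<le> M" and nz: "\<And>j. w j \<noteq> 0"
    using w unfolding admissible_weight_def by blast
  obtain x where x: "x \<in> lp p"
    and dens: "\<And>U. lp_open p U \<Longrightarrow> U \<noteq> {} \<Longrightarrow> 0 < upper_banach_density (return_set (pseudo_shift f w) x U)"
    using rh unfolding reiteratively_hypercyclic_def by blast
  have hit: "\<exists>n. (pseudo_shift f w ^^ n) x \<in> U" if "lp_open p U" "U \<noteq> {}" for U
  proof -
    have "return_set (pseudo_shift f w) x U \<noteq> {}"
      using dens[OF that] upper_banach_density_empty by auto
    then show ?thesis unfolding return_set_def by blast
  qed
  have shift: "aperiodic_shift f w j" for j
    using f nz hypercyclic_imp_aperiodic[OF p x hit] by unfold_locales auto
  have fixed_lp: "aperiodic_shift.fixed_vec f w j \<in> lp p" for j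
  proof (rule aperiodic_shift.fixed_vec_lp[OF shift p M x dens])
    show "lp_open p {z \<in> lp p. lp_norm p (\<lambda>i. z i - unit_vec j i) < 1 / 2}"
      by (rule lp_open_ball[OF p unit_vec_lp])
    have "unit_vec j \<in> {z \<in> lp p. lp_norm p (\<lambda>i. z i - (unit_vec j i :: 'k)) < 1 / 2}"
      by (simp add: unit_vec_lp lp_norm_zero)
    then show "{z \<in> lp p. lp_norm p (\<lambda>i. z i - (unit_vec j i :: 'k)) < 1 / 2} \<noteq> {}" by blast
  qed
  define P where "P j n = aperiodic_shift.periodic_vec f w j n" for j n
  have P_lp: "P j n \<in> lp p" for j n
    unfolding P_def by (rule aperiodic_shift.periodic_vec_lp[OF shift p fixed_lp])
  have P_per: "(pseudo_shift f w ^^ n) (P j n) = P j n" for j n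
    unfolding P_def by (rule aperiodic_shift.periodic_vec_periodic[OF shift])
  obtain F where F: "finite F" and "\<And>G. F \<subseteq> G \<Longrightarrow> lp_norm p (\<lambda>j. if j \<in> G then 0 else y j) < e / 2"
    using lp_tail_small[OF p y, of "e / 2"] e by auto
  then have tail: "lp_norm p (\<lambda>j. if j \<in> F then 0 else y j) < e / 2" by blast
  \<comment> \<open>Replacing the unit vectors costs at most the sum of
    \<open>norm (y j) * d\<close> over \<open>F\<close>, hence at most \<open>e / 2\<close>; the
    summand 1 keeps the denominator positive.\<close>
  define d where "d = e / (2 * (1 + (\<Sum>j\<in>F. norm (y j))))"
  have s0: "0 < 1 + (\<Sum>j\<in>F. norm (y j))" by (simp add: add_pos_nonneg sum_nonneg)
  then have d: "d > 0" unfolding d_def using e by simp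
  have "eventually (\<lambda>n. \<forall>j\<in>F. lp_norm p (\<lambda>i. P j n i - unit_vec j i) < d) sequentially"
    unfolding P_def using F
    by (intro eventually_ball_finite ballI aperiodic_shift.periodic_vec_approx[OF shift p fixed_lp d])
  then show ?thesis
  proof eventually_elim
    case (elim n)
    define z where "z i = (\<Sum>j\<in>F. y j * P j n i)" for i
    have z: "z \<in> lp p" unfolding z_def
      using lp_sum[OF p F, of "\<lambda>j i. y j * P j n i"] lp_cmult(1)[OF p P_lp] by blast
    have per: "(pseudo_shift f w ^^ n) z = z"
    proof
      fix i
      have "weight_prod f w n i * P j n ((f ^^ n) i) = P j n i" for j
        using fun_cong[OF P_per, of n j i] unfolding pseudo_shift_funpow .
      then show "(pseudo_shift f w ^^ n) z i = z i"
        unfolding pseudo_shift_funpow z_def by (simp add: sum_distrib_left mult.left_commute)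
    qed
    let ?v = "\<lambda>j i. y j * (P j n i - unit_vec j i)"
    have D: "(\<lambda>i. P j n i - unit_vec j i) \<in> lp p" for j by (rule lp_diff[OF p P_lp unit_vec_lp])
    have "(\<lambda>i. \<Sum>j\<in>F. ?v j i) \<in> lp p" and "lp_norm p (\<lambda>i. \<Sum>j\<in>F. ?v j i) \<le> (\<Sum>j\<in>F. lp_norm p (?v j))"
      using lp_sum[OF p F, of ?v] lp_cmult(1)[OF p D] by blast+
    note this(2)
    also have "(\<Sum>j\<in>F. lp_norm p (?v j)) \<le> (\<Sum>j\<in>F. norm (y j) * d)"
      unfolding lp_cmult(2)[OF p D] using elim by (intro sum_mono mult_left_mono) (auto intro: less_imp_le)
    also have "\<dots> = (\<Sum>j\<in>F. norm (y j)) * d" by (rule sum_distrib_right[symmetric])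
    also have "\<dots> \<le> (1 + (\<Sum>j\<in>F. norm (y j))) * d" using d by (intro mult_right_mono) auto
    also have "\<dots> = e / 2" unfolding d_def using s0 by (simp add: field_simps)
    finally have 1: "lp_norm p (\<lambda>i. \<Sum>j\<in>F. ?v j i) \<le> e / 2" .
    define u where "u i = (if i \<in> F then y i else 0)" for i
    have "u \<in> lp p" by (rule lp_mono(1)[OF p y]) (simp add: u_def)
    have "(\<Sum>j\<in>F. y j * unit_vec j i) = u i" for i
      unfolding u_def unit_vec_def using F by (simp add: if_distrib cong: if_cong)
    then have "(\<lambda>i. \<Sum>j\<in>F. ?v j i) = (\<lambda>i. z i - u i)"
      unfolding z_def by (simp add: right_diff_distrib sum_subtractf)
    with 1 have "lp_norm p (\<lambda>i. z i - u i) \<le> e / 2" by simp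
    moreover have "lp_norm p (\<lambda>i. u i - y i) < e / 2"
    proof -
      have "(\<lambda>i. y i - u i) = (\<lambda>j. if j \<in> F then 0 else y j)" unfolding u_def by auto
      with tail show ?thesis by (simp add: lp_norm_minus_commute[of p u y])
    qed
    ultimately have "lp_norm p (\<lambda>i. z i - y i) < e"
      using lp_norm_diff_triangle[OF p z \<open>u \<in> lp p\<close> y] by simp
    with z per show ?case by blast
  qed
qed

section \<open>Direct sums\<close>

lemma direct_sum_funpow:
  assumes "i \<in> I" shows "(direct_sum I T ^^ n) z i = (T i ^^ n) (z i)"
  using assms by (induction n) (simp_all add: direct_sum_def)

lemma direct_sum_funpow_lp_prod:
  assumes "z \<in> lp_prod p I" "\<And>i x. i \<in> I \<Longrightarrow> x \<in> lp p \<Longrightarrow> T i x \<in> lp p"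
  shows "(direct_sum I T ^^ n) z \<in> lp_prod p I"
  using assms by (induction n) (auto simp: lp_prod_def direct_sum_def)

lemma diag_lp_prod: "x \<in> lp p \<Longrightarrow> diag I x \<in> lp_prod p I"
  unfolding diag_def lp_prod_def by auto

lemma disjoint_reiteratively_hypercyclic_imp_hypercyclic:
  assumes "disjoint_reiteratively_hypercyclic p I T"
  shows "disjoint_hypercyclic p I T"
proof -
  obtain x where x: "x \<in> lp p" and dens: "\<And>U. lp_prod_open p I U \<Longrightarrow> U \<noteq> {} \<Longrightarrow>
      upper_banach_density (return_set (direct_sum I T) (diag I x) U) > 0"
    using assms unfolding disjoint_reiteratively_hypercyclic_def by blast
  have "\<exists>n. (direct_sum I T ^^ n) (diag I x) \<in> U" if "lp_prod_open p I U" "U \<noteq> {}" for U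
  proof -
    have "return_set (direct_sum I T) (diag I x) U \<noteq> {}"
      using dens[OF that] upper_banach_density_empty by auto
    then show ?thesis unfolding return_set_def by blast
  qed
  with x show ?thesis unfolding disjoint_hypercyclic_def by blast
qed

text \<open>An open set \<open>U\<close> in one factor corresponds to the open cylinder
  \<open>V\<close> in the product, and both have the same return times.\<close>

lemma disjoint_reiteratively_hypercyclic_imp_component:
  assumes "disjoint_reiteratively_hypercyclic p I T" and i: "i \<in> I"
    and T: "\<And>i x. i \<in> I \<Longrightarrow> x \<in> lp p \<Longrightarrow> T i x \<in> lp p"
  shows "reiteratively_hypercyclic p (T i)"
proof -
  obtain x where x: "x \<in> lp p" and dens: "\<And>U. lp_prod_open p I U \<Longrightarrow> U \<noteq> {} \<Longrightarrow>
      upper_banach_density (return_set (direct_sum I T) (diag I x) U) > 0"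
    using assms(1) unfolding disjoint_reiteratively_hypercyclic_def by blast
  have "upper_banach_density (return_set (T i) x U) > 0" if U: "lp_open p U" "U \<noteq> {}" for U
  proof -
    define V where "V = {z \<in> lp_prod p I. z i \<in> U}"
    have "lp_prod_open p I V" unfolding lp_prod_open_def
    proof (intro conjI ballI)
      fix y assume y: "y \<in> V"
      then obtain e where e: "e > 0" "\<And>z. z \<in> lp p \<Longrightarrow> lp_norm p (\<lambda>j. z j - y i j) < e \<Longrightarrow> z \<in> U"
        using U(1) unfolding lp_open_def V_def by blast
      show "\<exists>e>0. \<forall>z\<in>lp_prod p I. (\<forall>i\<in>I. lp_norm p (\<lambda>j. z i j - y i j) < e) \<longrightarrow> z \<in> V"
        using e i unfolding V_def lp_prod_def by (intro exI[of _ e]) auto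
    qed (auto simp: V_def)
    moreover obtain u where u: "u \<in> U" using U(2) by blast
    then have "diag I u \<in> V"
      using U(1) i unfolding V_def by (auto simp: lp_open_def diag_def intro!: diag_lp_prod[unfolded diag_def])
    then have "V \<noteq> {}" by blast
    moreover have "return_set (direct_sum I T) (diag I x) V = return_set (T i) x U"
      unfolding return_set_def V_def
      using direct_sum_funpow_lp_prod[OF diag_lp_prod[OF x] T] direct_sum_funpow[where T=T and z="diag I x", OF i] i
      by (auto simp: diag_def)
    ultimately show ?thesis using dens[of V] by simp
  qed
  with x show ?thesis unfolding reiteratively_hypercyclic_def by blast
qed

text \<open>Hypercyclicity supplies a single visit near a periodic point of the direct sum;
  continuity of finitely many iterates turns this visit into a long progression of return
  times.\<close>

lemma disjoint_hypercyclic_imp_reiteratively: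
  fixes f :: "nat \<Rightarrow> 'i \<Rightarrow> 'i" and w :: "nat \<Rightarrow> 'i \<Rightarrow> 'k::real_normed_field"
  assumes p: "p \<ge> 1" and I: "finite I"
    and fw: "\<And>i. i \<in> I \<Longrightarrow> inj (f i) \<and> admissible_weight (w i)"
    and rh: "\<And>i. i \<in> I \<Longrightarrow> reiteratively_hypercyclic p (pseudo_shift (f i) (w i))"
    and dh: "disjoint_hypercyclic p I (\<lambda>i. pseudo_shift (f i) (w i))"
  shows "disjoint_reiteratively_hypercyclic p I (\<lambda>i. pseudo_shift (f i) (w i))"
proof -
  let ?T = "\<lambda>i. pseudo_shift (f i) (w i)"
  have "\<forall>i\<in>I. \<exists>M. \<forall>j. norm (w i j) \<le> M" using fw unfolding admissible_weight_def by blast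
  then obtain m where m: "\<And>i j. i \<in> I \<Longrightarrow> norm (w i j) \<le> m i" by metis
  \<comment> \<open>A common bound for all the weights, raised to at least 1 so that its powers
    increase with the exponent.\<close>
  define M where "M = Max (insert 1 (m ` I))"
  have M1: "M \<ge> 1" unfolding M_def using I by simp
  have M: "norm (w i j) \<le> M" if "i \<in> I" for i j
  proof -
    have "m i \<le> M" unfolding M_def using I that by (intro Max_ge) auto
    with m[OF that, of j] show ?thesis by simp
  qed
  have T_lp: "?T i x \<in> lp p" if "i \<in> I" "x \<in> lp p" for i x
    using pseudo_shift_lp(1)[where w="w i", OF p _ M[OF that(1)] that(2)] fw that(1) by blast
  obtain x where x: "x \<in> lp p"
    and hit: "\<And>U. lp_prod_open p I U \<Longrightarrow> U \<noteq> {} \<Longrightarrow> \<exists>n. (direct_sum I ?T ^^ n) (diag I x) \<in> U"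
    using dh unfolding disjoint_hypercyclic_def by blast
  have "upper_banach_density (return_set (direct_sum I ?T) (diag I x) U) > 0"
    if U: "lp_prod_open p I U" "U \<noteq> {}" for U
  proof -
    obtain y where yU: "y \<in> U" using U(2) by blast
    then have y: "y \<in> lp_prod p I" using U(1) unfolding lp_prod_open_def by blast
    obtain e where e: "e > 0" and
      eU: "\<And>z. z \<in> lp_prod p I \<Longrightarrow> (\<And>i. i \<in> I \<Longrightarrow> lp_norm p (\<lambda>j. z i j - y i j) < e) \<Longrightarrow> z \<in> U"
      using U(1) yU unfolding lp_prod_open_def by blast
    have "eventually (\<lambda>n. \<exists>z\<in>lp p. (?T i ^^ n) z = z \<and> lp_norm p (\<lambda>j. z j - y i j) < e / 2) sequentially"
      if "i \<in> I" for i
      by (rule reiteratively_hypercyclic_imp_periodic_dense[OF p])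
        (use fw[OF that] rh[OF that] y that e in \<open>auto simp: lp_prod_def\<close>)
    then have "eventually (\<lambda>n. \<forall>i\<in>I. \<exists>z\<in>lp p. (?T i ^^ n) z = z \<and> lp_norm p (\<lambda>j. z j - y i j) < e / 2) sequentially"
      using I by (intro eventually_ball_finite) auto
    then have "eventually (\<lambda>n. n \<ge> 1 \<and> (\<forall>i\<in>I. \<exists>z\<in>lp p. (?T i ^^ n) z = z \<and> lp_norm p (\<lambda>j. z j - y i j) < e / 2)) sequentially"
      by (intro eventually_conj eventually_ge_at_top)
    then obtain n where n: "n \<ge> 1" and
      "\<forall>i\<in>I. \<exists>z\<in>lp p. (?T i ^^ n) z = z \<and> lp_norm p (\<lambda>j. z j - y i j) < e / 2"
      using eventually_happens'[OF sequentially_bot] by blast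
    then obtain z0 where z0: "\<And>i. i \<in> I \<Longrightarrow> z0 i \<in> lp p" "\<And>i. i \<in> I \<Longrightarrow> (?T i ^^ n) (z0 i) = z0 i"
      "\<And>i. i \<in> I \<Longrightarrow> lp_norm p (\<lambda>j. z0 i j - y i j) < e / 2" by metis
    define z where "z i = (if i \<in> I then z0 i else (\<lambda>_. 0))" for i
    have z: "z \<in> lp_prod p I" unfolding lp_prod_def z_def using z0 by auto
    have per: "(?T i ^^ (q * n)) (z i) = z i" if "i \<in> I" for i q
      using z0(2)[OF that] that by (induction q) (auto simp: z_def funpow_add)
    show ?thesis
    proof (rule upper_banach_density_pos_of_progressions[OF n])
      fix K
      \<comment> \<open>The deviation from \<open>z\<close> grows by a factor of at most
        \<open>M ^ (K * n)\<close> within \<open>K * n\<close> steps, so it stays below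
        \<open>e / 2\<close> up to the end of the progression.\<close>
      define r where "r = e / 2 / M ^ (K * n)"
      have r: "r > 0" unfolding r_def using e M1 by simp
      let ?V = "{v \<in> lp_prod p I. \<forall>i\<in>I. lp_norm p (\<lambda>j. v i j - z i j) < r}"
      have "z \<in> ?V" using z r by (simp add: lp_norm_zero)
      then obtain k where k: "(direct_sum I ?T ^^ k) (diag I x) \<in> ?V"
        using hit[OF lp_prod_open_ball[OF p z I, of r]] by blast
      define v where "v = (direct_sum I ?T ^^ k) (diag I x)"
      have v: "v \<in> lp_prod p I" "\<And>i. i \<in> I \<Longrightarrow> lp_norm p (\<lambda>j. v i j - z i j) < r"
        using k unfolding v_def by auto
      have "k + q * n \<in> return_set (direct_sum I ?T) (diag I x) U" if q: "q \<le> K" for q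
      proof -
        define u where "u = (direct_sum I ?T ^^ (q * n)) v"
        have u: "u \<in> lp_prod p I" unfolding u_def by (rule direct_sum_funpow_lp_prod[OF v(1) T_lp])
        have "u \<in> U"
        proof (rule eU[OF u])
          fix i assume i: "i \<in> I"
          have vi: "v i \<in> lp p" and zi: "z i \<in> lp p" and ui: "u i \<in> lp p" and yi: "y i \<in> lp p"
            using v(1) z u y i unfolding lp_prod_def by auto
          have "u i = (?T i ^^ (q * n)) (v i)" unfolding u_def by (rule direct_sum_funpow[OF i])
          then have "(\<lambda>j. u i j - z i j) = (?T i ^^ (q * n)) (\<lambda>j. v i j - z i j)"
            unfolding pseudo_shift_funpow_diff using per[OF i, of q] by simp
          then have "lp_norm p (\<lambda>j. u i j - z i j) \<le> M ^ (q * n) * lp_norm p (\<lambda>j. v i j - z i j)"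
            using pseudo_shift_funpow_lp[where w="w i" and n="q * n", OF p _ M[OF i] lp_diff[OF p vi zi]] fw[OF i] by simp
          also have "\<dots> \<le> M ^ (K * n) * lp_norm p (\<lambda>j. v i j - z i j)"
            using M1 q lp_norm_nonneg by (intro mult_right_mono power_increasing) auto
          also have "\<dots> < M ^ (K * n) * r" using v(2)[OF i] M1 by (intro mult_strict_left_mono) auto
          also have "\<dots> = e / 2" unfolding r_def using M1 by simp
          finally have "lp_norm p (\<lambda>j. u i j - z i j) < e / 2" .
          moreover have "lp_norm p (\<lambda>j. z i j - y i j) < e / 2" using z0(3)[OF i] i by (simp add: z_def)
          ultimately show "lp_norm p (\<lambda>j. u i j - y i j) < e"
            using lp_norm_diff_triangle[OF p ui zi yi] by simp
        qed
        moreover have "u = (direct_sum I ?T ^^ (k + q * n)) (diag I x)"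
          unfolding u_def v_def add.commute[of k] by (simp add: funpow_add)
        ultimately show ?thesis unfolding return_set_def by simp
      qed
      then show "\<exists>k. \<forall>q\<le>K. k + q * n \<in> return_set (direct_sum I ?T) (diag I x) U" by blast
    qed
  qed
  with x show ?thesis unfolding disjoint_reiteratively_hypercyclic_def by blast
qed

text \<open>Stated for injective maps on an arbitrary index type, so that the unilateral and the
  bilateral case are both instances.\<close>

lemma disjoint_reiteratively_hypercyclic_iff:
  fixes f :: "nat \<Rightarrow> 'i \<Rightarrow> 'i" and w :: "nat \<Rightarrow> 'i \<Rightarrow> 'k::real_normed_field"
  assumes p: "p \<ge> 1" and I: "finite I"
    and fw: "\<And>i. i \<in> I \<Longrightarrow> inj (f i) \<and> admissible_weight (w i)"
  shows "disjoint_reiteratively_hypercyclic p I (\<lambda>i. pseudo_shift (f i) (w i)) \<longleftrightarrow>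
    (\<forall>i\<in>I. reiteratively_hypercyclic p (pseudo_shift (f i) (w i))) \<and>
    disjoint_hypercyclic p I (\<lambda>i. pseudo_shift (f i) (w i))"
proof -
  have T: "pseudo_shift (f i) (w i) x \<in> lp p" if "i \<in> I" "x \<in> lp p" for i x
    using fw[OF that(1)] pseudo_shift_lp(1)[OF p _ _ that(2)] unfolding admissible_weight_def by blast
  show ?thesis
  proof (intro iffI conjI ballI)
    assume drh: "disjoint_reiteratively_hypercyclic p I (\<lambda>i. pseudo_shift (f i) (w i))"
    show "disjoint_hypercyclic p I (\<lambda>i. pseudo_shift (f i) (w i))"
      by (rule disjoint_reiteratively_hypercyclic_imp_hypercyclic[OF drh])
    show "reiteratively_hypercyclic p (pseudo_shift (f i) (w i))" if "i \<in> I" for i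
      by (rule disjoint_reiteratively_hypercyclic_imp_component[OF drh that T])
  next
    assume *: "(\<forall>i\<in>I. reiteratively_hypercyclic p (pseudo_shift (f i) (w i))) \<and>
      disjoint_hypercyclic p I (\<lambda>i. pseudo_shift (f i) (w i))"
    show "disjoint_reiteratively_hypercyclic p I (\<lambda>i. pseudo_shift (f i) (w i))"
      by (rule disjoint_hypercyclic_imp_reiteratively[OF p I fw]) (use * in auto)
  qed
qed

theorem corollary3p5:
  fixes p :: real and N :: nat
  assumes "1 < p" and "N > 2"
  shows "(\<forall>(f :: nat \<Rightarrow> nat \<Rightarrow> nat) (w :: nat \<Rightarrow> nat \<Rightarrow> 'k::real_normed_field).
            (\<forall>i\<in>{1..N}. inj (f i) \<and> admissible_weight (w i)) \<longrightarrow>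
            (disjoint_reiteratively_hypercyclic p {1..N} (\<lambda>i. pseudo_shift (f i) (w i)) \<longleftrightarrow>
              (\<forall>i\<in>{1..N}. reiteratively_hypercyclic p (pseudo_shift (f i) (w i))) \<and>
              disjoint_hypercyclic p {1..N} (\<lambda>i. pseudo_shift (f i) (w i))))
       \<and> (\<forall>(f :: nat \<Rightarrow> int \<Rightarrow> int) (w :: nat \<Rightarrow> int \<Rightarrow> 'k).
            (\<forall>i\<in>{1..N}. bij (f i) \<and> admissible_weight (w i)) \<longrightarrow>
            (disjoint_reiteratively_hypercyclic p {1..N} (\<lambda>i. pseudo_shift (f i) (w i)) \<longleftrightarrow>
              (\<forall>i\<in>{1..N}. reiteratively_hypercyclic p (pseudo_shift (f i) (w i))) \<and>
              disjoint_hypercyclic p {1..N} (\<lambda>i. pseudo_shift (f i) (w i))))"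
proof (intro conjI allI impI)
  have p: "p \<ge> 1" using assms(1) by simp
  show "disjoint_reiteratively_hypercyclic p {1..N} (\<lambda>i. pseudo_shift (f i) (w i)) \<longleftrightarrow>
              (\<forall>i\<in>{1..N}. reiteratively_hypercyclic p (pseudo_shift (f i) (w i))) \<and>
              disjoint_hypercyclic p {1..N} (\<lambda>i. pseudo_shift (f i) (w i))"
    if "\<forall>i\<in>{1..N}. inj (f i) \<and> admissible_weight (w i)"
    for f :: "nat \<Rightarrow> nat \<Rightarrow> nat" and w :: "nat \<Rightarrow> nat \<Rightarrow> 'k"
    by (rule disjoint_reiteratively_hypercyclic_iff[OF p]) (use that in auto)
  show "disjoint_reiteratively_hypercyclic p {1..N} (\<lambda>i. pseudo_shift (f i) (w i)) \<longleftrightarrow>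
              (\<forall>i\<in>{1..N}. reiteratively_hypercyclic p (pseudo_shift (f i) (w i))) \<and>
              disjoint_hypercyclic p {1..N} (\<lambda>i. pseudo_shift (f i) (w i))"
    if "\<forall>i\<in>{1..N}. bij (f i) \<and> admissible_weight (w i)"
    for f :: "nat \<Rightarrow> int \<Rightarrow> int" and w :: "nat \<Rightarrow> int \<Rightarrow> 'k"
    by (rule disjoint_reiteratively_hypercyclic_iff[OF p]) (use that in \<open>auto intro: bij_is_inj\<close>)
qed

end
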